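(* Let $A$ and $B$ be real numbers with $A>2$ and $B\geqslant 4A/(A-2)$, and set $C=1-2/A-4/B$. Let $n$ be an integer that is not a prime power and has no prime divisor smaller than $B$. Let $r$ and $d$ be positive integers with \[dr\left(1-\frac{A}{d}\right)\leqslant \frac{A^2C\log n}{2\log 2}.\] Let $\mathrm{P}$ be the product test of $r$ Miller-Rabin tests and one Galois test of dimension $d$ (for $n$). Then the density of bad witnesses for $\mathrm{P}$ is at most \[2^{-\frac{rd}{A}\left(1-\frac{A}{d}\right)}.\]
   Context: $\log$ is the natural logarithm. Miller-Rabin test: for odd $n$ write $n-1=m2^k$ with $m$ odd; the set of witnesses is $(\mathbb{Z}/n\mathbb{Z})^*$, and a witness $x$ yields "prime" iff $x^m=1$ or $x^{m2^i}=-1$ for some $0\leqslant i<k$, and "composite" otherwise. Galois test of dimension $d$: let $S$ be a cyclic $\mathbb{Z}/n\mathbb{Z}$-algebra of dimension $d$, i.e. a commutative $\mathbb{Z}/n\mathbb{Z}$-algebra with a cyclic group $\mathcal{G}=\langle\sigma\rangle$ of order $d$ of algebra automorphisms such that $S^{\mathcal{G}}=\mathbb{Z}/n\mathbb{Z}$ and for every $\tau\in\mathcal{G}\setminus\{\mathrm{id}\}$ and every maximal ideal $\mathfrak{m}$ of $S$ there is $s\in S$ with $\tau(s)-s\notin\mathfrak{m}$ (such $S$ is free of rank $d$ over $\mathbb{Z}/n\mathbb{Z}$); the witnesses are the units $x\in S^*$, and $x$ yields "prime" iff $\sigma(x)=x^n$, "composite" otherwise. Product test: given tests with witness sets $W^1,\dots,W^s$,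 the product test has witness set $W^1\times\dots\times W^s$ and a tuple yields "prime" iff every coordinate yields "prime" in its test. For composite $n$, a bad witness is a witness yielding "prime", and the density of bad witnesses is the proportion of bad witnesses among all witnesses. *)

theory Defs
  imports
    "HOL-Algebra.Algebra"
    "HOL-Number_Theory.Number_Theory"
begin

section \<open>Tests and their products\<close>

record 'w test =
  witnesses :: "'w set"
  yields_prime :: "'w \<Rightarrow> bool"

definition bad_witnesses :: "'w test \<Rightarrow> 'w set" where
  "bad_witnesses T = {x \<in> witnesses T. yields_prime T x}"

text \<open>Both cardinalities are meant for tests with a finite set of witnesses.\<close>

definition bad_density :: "'w test \<Rightarrow> real" where
  "bad_density T = real (card (bad_witnesses T)) / real (card (witnesses T))"

text \<open>
  The factors of a product test may have witnesses of different types, so products are provided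
  in two forms: of a family of tests with a common witness type, and of two arbitrary tests.
\<close>

definition family_test :: "'i set \<Rightarrow> ('i \<Rightarrow> 'w test) \<Rightarrow> ('i \<Rightarrow> 'w) test" where
  "family_test I T =
     \<lparr>witnesses = (\<Pi>\<^sub>E i\<in>I. witnesses (T i)),
      yields_prime = (\<lambda>x. \<forall>i\<in>I. yields_prime (T i) (x i))\<rparr>"

definition pair_test :: "'v test \<Rightarrow> 'w test \<Rightarrow> ('v \<times> 'w) test" where
  "pair_test T U =
     \<lparr>witnesses = witnesses T \<times> witnesses U,
      yields_prime = (\<lambda>(x, y). yields_prime T x \<and> yields_prime U y)\<rparr>"


section \<open>The Miller-Rabin test\<close>

text \<open>For odd \<open>n > 1\<close> the pair \<open>(m, k)\<close> exists and is unique.\<close>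

definition miller_rabin_test :: "nat \<Rightarrow> int test" where
  "miller_rabin_test n = (let R = residue_ring (int n) in
     \<lparr>witnesses = Units R,
      yields_prime = (\<lambda>x. \<exists>m k :: nat. odd m \<and> n - 1 = m * 2 ^ k \<and>
        (x [^]\<^bsub>R\<^esub> m = \<one>\<^bsub>R\<^esub> \<or> (\<exists>i<k. x [^]\<^bsub>R\<^esub> (m * 2 ^ i) = \<ominus>\<^bsub>R\<^esub> \<one>\<^bsub>R\<^esub>)))\<rparr>)"


section \<open>Cyclic algebras and the Galois test\<close>

text \<open>As in \<^const>\<open>AutoGroup\<close>, automorphisms are extensional functions on the carrier.\<close>

definition algebra_auts ::
    "('r, 'x) ring_scheme \<Rightarrow> ('r, 'a, 'y) module_scheme \<Rightarrow> ('a \<Rightarrow> 'a) set" where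
  "algebra_auts R S =
     {f \<in> ring_hom S S \<inter> Bij (carrier S).
        \<forall>a\<in>carrier R. \<forall>s\<in>carrier S. f (a \<odot>\<^bsub>S\<^esub> s) = a \<odot>\<^bsub>S\<^esub> f s}"

definition AlgebraAutGroup ::
    "('r, 'x) ring_scheme \<Rightarrow> ('r, 'a, 'y) module_scheme \<Rightarrow> ('a \<Rightarrow> 'a) monoid" where
  "AlgebraAutGroup R S = BijGroup (carrier S) \<lparr>carrier := algebra_auts R S\<rparr>"

definition fixed_elements :: "('a, 'x) ring_scheme \<Rightarrow> ('a \<Rightarrow> 'a) set \<Rightarrow> 'a set" where
  "fixed_elements S G = {s \<in> carrier S. \<forall>\<tau>\<in>G. \<tau> s = s}"

text \<open>
  \<open>cyclic_algebra R S \<sigma> d\<close>: \<open>S\<close> is a cyclic \<open>R\<close>-algebra of dimension \<open>d\<close> with chosen generator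
  \<open>\<sigma>\<close> of its group. Condition \<open>fixed\<close> is the identification of \<open>R\<close> with the ring of invariants
  through the structure map \<open>a \<mapsto> a \<odot> 1\<close>; in particular this map is injective.
\<close>

locale cyclic_algebra = algebra R S
  for R :: "('r, 'x) ring_scheme" (structure)
    and S :: "('r, 'a, 'y) module_scheme" (structure) +
  fixes \<sigma> :: "'a \<Rightarrow> 'a" and d :: nat and G :: "('a \<Rightarrow> 'a) set"
  defines "G \<equiv> generate (AlgebraAutGroup R S) {\<sigma>}"
  assumes aut: "\<sigma> \<in> carrier (AlgebraAutGroup R S)"
    and dim_pos: "d > 0"
    and order_G: "card G = d"
    and fixed: "bij_betw (\<lambda>a. a \<odot>\<^bsub>S\<^esub> \<one>\<^bsub>S\<^esub>) (carrier R) (fixed_elements S G)"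
    and galois: "\<lbrakk>\<tau> \<in> G; \<tau> \<noteq> \<one>\<^bsub>AlgebraAutGroup R S\<^esub>; maximalideal M S\<rbrakk>
      \<Longrightarrow> \<exists>s\<in>carrier S. \<tau> s \<ominus>\<^bsub>S\<^esub> s \<notin> M"

definition galois_test :: "nat \<Rightarrow> ('a, 'y) ring_scheme \<Rightarrow> ('a \<Rightarrow> 'a) \<Rightarrow> 'a test" where
  "galois_test n S \<sigma> =
     \<lparr>witnesses = Units S,
      yields_prime = (\<lambda>x. \<sigma> x = x [^]\<^bsub>S\<^esub> n)\<rparr>"

end

theory Submission
  imports Defs
begin

text \<open>
  Let \<open>n\<close> have \<open>s\<close> prime divisors. The bad Miller-Rabin witnesses satisfy \<open>x ^ t = 1\<close> or
  \<open>x ^ t = -1\<close> for one fixed \<open>t\<close> for which \<open>-1\<close> is a \<open>t\<close>-th power; independent sign changes at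
  all primes but one show that their density is at most \<open>2 ^ (1 - s)\<close>. This settles the case
  \<open>d \<le> s A\<close>.

  If \<open>d > s A\<close>, take a prime power \<open>p ^ v\<close> exactly dividing \<open>n\<close> with \<open>(p ^ v) ^ s \<ge> n\<close>, and a
  maximal ideal above \<open>p\<close>, with \<open>g\<close> conjugates and residue field of order \<open>q\<close>. The Galois condition
  makes \<open>\<sigma> ^ g\<close> act on the residue field with order \<open>d / g\<close>, hence \<open>q ^ g \<ge> p ^ d\<close>. The unit group of
  the component of \<open>S\<close> at \<open>p\<close> has at least \<open>(q - 1) ^ g * q ^ (g * (v - 1))\<close> elements, whereas its
  elements with \<open>\<sigma> x = x ^ n\<close> are determined by their residues. There are at most \<open>q\<close> of them, and
  if \<open>g = 1\<close>, where \<open>\<sigma>\<close> is a power of Frobenius on the residue field, at most \<open>n * sqrt q\<close> since \<open>n\<close>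
  is not a power of \<open>p\<close>.
  So the density is at most \<open>n * (p ^ (v / 2) * (1 - 1 / p)) ^ (-d)\<close>, and the claim follows by taking
  logarithms.
\<close>

section \<open>The Miller-Rabin test\<close>

text \<open>Write \<open>s\<close> for the number of prime divisors. At \<open>d = s * A\<close> the
  two kinds of test exchange roles: up to it the Miller-Rabin factor alone gives the exponent,
  beyond it this factor is merely bounded by 1. With \<open>L = ln (p ^ v) \<ge> ln n / s\<close>,
  the logarithm of the Galois density is at most \<open>ln n - d * L * (1 / 2 - 2 / B)\<close>. The
  1/2 reflects that bad elements are counted up to a square root of the number of residues, and
  \<open>2 / B\<close> pays for the factor \<open>1 - 1 / p\<close>. For \<open>d > s * A\<close>
  this is at most \<open>- (A * C / 2) * ln n\<close>, which is the origin of \<open>C\<close>; the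
  hypothesis on \<open>d * r\<close>, divided by \<open>A\<close>, compares it with the claimed
  exponent. The main obstacle is to bound the number of units of \<open>S\<close> from below with
  only the cyclic action at hand. Units are produced through norms: a product over a full orbit of
  \<open>\<sigma>\<close> is invariant, hence a scalar, and invertibility of a scalar is arithmetic
  modulo \<open>n\<close>. Counting is done with finiteness of \<open>Units S\<close> alone.\<close>

lemma bad_density_le_one:
  "bad_density T \<le> 1"
proof (cases "finite (witnesses T)")
  case True
  then have "card (bad_witnesses T) \<le> card (witnesses T)"
    unfolding bad_witnesses_def by (intro card_mono) auto
  then show ?thesis
    unfolding bad_density_def by (cases "card (witnesses T) = 0") (auto simp: divide_le_eq_1)
\<comment> \<open>An infinite witness set has \<open>card\<close> 0, so the density is a quotient by
  0 and equals 0.\<close>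
qed (simp add: bad_density_def)

lemma bad_density_pair_test:
  "bad_density (pair_test T U) = bad_density T * bad_density U"
proof -
  have "bad_witnesses (pair_test T U) = bad_witnesses T \<times> bad_witnesses U"
    by (auto simp: bad_witnesses_def pair_test_def)
  moreover have "witnesses (pair_test T U) = witnesses T \<times> witnesses U"
    by (simp add: pair_test_def)
  ultimately show ?thesis
    by (simp add: bad_density_def card_cartesian_product)
qed

lemma bad_density_family_test_const:
  assumes "finite I"
  shows "bad_density (family_test I (\<lambda>_. T)) = bad_density T ^ card I"
proof -
  have "bad_witnesses (family_test I (\<lambda>_. T)) = (\<Pi>\<^sub>E i\<in>I. bad_witnesses T)"
    by (auto simp: bad_witnesses_def family_test_def PiE_iff extensional_def)
  moreover have "witnesses (family_test I (\<lambda>_. T)) = (\<Pi>\<^sub>E i\<in>I. witnesses T)"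
    by (simp add: family_test_def)
  ultimately show ?thesis
    using assms by (simp add: bad_density_def card_PiE power_divide)
qed

section \<open>Sign changes at the prime divisors and bad Miller-Rabin witnesses\<close>

lemma odd_part_unique:
  fixes m m' k k' :: nat
  assumes "odd m" "odd m'" "m * 2 ^ k = m' * 2 ^ k'"
  shows "m = m' \<and> k = k'"
proof -
  have "multiplicity 2 (a * 2 ^ b) = b" if "odd a" for a b :: nat
  proof -
    have "multiplicity 2 (a * 2 ^ b) = multiplicity 2 a + multiplicity 2 ((2::nat) ^ b)"
      using that by (intro prime_elem_multiplicity_mult_distrib) (auto intro: ccontr)
    also have "multiplicity 2 a = 0"
      using that by (simp add: not_dvd_imp_multiplicity_0)
    finally show ?thesis by simp
  qed
  with assms have "k = k'" by metis
  with assms show ?thesis by simp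
qed

text \<open>The Chinese remainder theorem glues the residues of \<open>w\<close> at the primes in
  \<open>I\<close> with 1 at the others. Prescribing signs modulo primes instead of prime powers is
  enough to tell sets apart, and nonzero residues at all primes make \<open>y\<close> coprime to
  \<open>n\<close>.\<close>

lemma exists_sign_pattern:
  fixes n t :: nat and w :: int
  assumes "n \<noteq> 0" and "t \<noteq> 0" and w: "[w ^ t = -1] (mod int n)"
  shows "\<exists>y::int. coprime y (int n) \<and>
    (\<forall>p\<in>prime_factors n. [y ^ t = (if p \<in> I then -1 else 1)] (mod int p))"
proof -
  have "\<exists>z::nat. \<forall>p\<in>prime_factors n. [z = (if p \<in> I then nat (w mod int p) else 1)] (mod p)"
    by (intro chinese_remainder_nat) (auto simp: in_prime_factors_iff intro!: primes_coprime)
  then obtain z :: nat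
    where z: "\<And>p. p \<in> prime_factors n \<Longrightarrow> [z = (if p \<in> I then nat (w mod int p) else 1)] (mod p)"
    by blast
  have zt: "[int z ^ t = (if p \<in> I then -1 else 1)] (mod int p)" if p: "p \<in> prime_factors n" for p
  proof -
    have p0: "p > 0" using p by (auto simp: in_prime_factors_iff intro: prime_gt_0_nat)
    have "[int z = int (if p \<in> I then nat (w mod int p) else 1)] (mod int p)"
      using z[OF p] by (simp only: cong_int_iff)
    then have "[int z = (if p \<in> I then w else 1)] (mod int p)"
      using p0 by (auto split: if_splits)
    then have "[int z ^ t = (if p \<in> I then w else 1) ^ t] (mod int p)"
      by (rule cong_pow)
    moreover have "[w ^ t = -1] (mod int p)"
      using w p by (rule_tac cong_dvd_modulus[OF w]) (auto simp: in_prime_factors_iff)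
    ultimately show ?thesis by (auto split: if_splits intro: cong_trans)
  qed
  have "coprime z n"
  proof (rule ccontr)
    assume "\<not> coprime z n"
    then have "\<not> is_unit (gcd z n)" using is_unit_gcd by blast
    moreover have "gcd z n \<noteq> 0" using \<open>n \<noteq> 0\<close> by simp
    ultimately obtain p where p: "Factorial_Ring.prime p" "p dvd gcd z n"
      using prime_divisor_exists by blast
    have pn: "p \<in> prime_factors n" using p \<open>n \<noteq> 0\<close> by (simp add: in_prime_factors_iff)
    have "int p dvd int z ^ t"
    proof -
      have "int p dvd int z" using p by simp
      then show ?thesis using \<open>t \<noteq> 0\<close> by (simp add: dvd_power dvd_trans[of _ "int z"])
    qed
    then have "int p dvd (if p \<in> I then -1 else 1)" using zt[OF pn] cong_dvd_iff by blast
    then show False using p by (auto split: if_splits)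
  qed
  then show ?thesis using zt by (intro exI[of _ "int z"]) auto
qed

text \<open>Multiplying the solutions by units \<open>Y I\<close>, one for each set \<open>I\<close>
  of primes other than \<open>p0\<close>, never yields a unit twice: the signs of the
  \<open>t\<close>-th power at the primes recover both factors.\<close>

lemma card_power_eq_pm1:
  fixes n t :: nat and w :: int
  assumes "odd n" "n > 1" "t \<noteq> 0" and w: "[w ^ t = -1] (mod int n)"
  defines "U \<equiv> {x::int. 0 < x \<and> x < int n \<and> coprime x (int n)}"
  shows "card {x\<in>U. [x ^ t = 1] (mod int n) \<or> [x ^ t = -1] (mod int n)}
           * 2 ^ (card (prime_factors n) - 1) \<le> card U"
proof -
  let ?B = "{x\<in>U. [x ^ t = 1] (mod int n) \<or> [x ^ t = -1] (mod int n)}"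
  let ?P = "prime_factors n"
  have "\<exists>Y. \<forall>I. coprime (Y I) (int n) \<and>
    (\<forall>p\<in>?P. [Y I ^ t = (if p \<in> I then -1 else 1)] (mod int p))"
    using exists_sign_pattern[OF _ \<open>t \<noteq> 0\<close> w] assms(2) by (intro choice allI) auto
  then obtain Y :: "nat set \<Rightarrow> int" where Y: "\<And>I. coprime (Y I) (int n)"
    "\<And>I p. p \<in> ?P \<Longrightarrow> [Y I ^ t = (if p \<in> I then -1 else 1)] (mod int p)"
    by blast
  obtain p0 where p0: "p0 \<in> ?P"
    using \<open>n > 1\<close> prime_divisor_exists[of n] by (auto simp: in_prime_factors_iff)
  \<comment> \<open>At \<open>p0\<close> all the \<open>Y I\<close> in question have
    \<open>t\<close>-th power 1, so the sign seen there is that of \<open>x\<close>; the signs at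
    the other primes then reveal \<open>I\<close>.\<close>
  let ?Q = "?P - {p0}"
  let ?f = "\<lambda>(x, I). (x * Y I) mod int n"
  have big: "p > 2" "int p dvd int n" if "p \<in> ?P" for p
  proof -
    have "Factorial_Ring.prime p" "p dvd n" using that by (auto simp: in_prime_factors_iff)
    moreover have "p \<noteq> 2" using \<open>odd n\<close> \<open>p dvd n\<close> by auto
    ultimately show "p > 2" "int p dvd int n"
      using prime_ge_2_nat[of p] by auto
  qed
  have ne: "\<not> [(1::int) = -1] (mod int p)" "\<not> [(-1::int) = 1] (mod int p)" if "p \<in> ?P" for p
    using big[OF that] zdvd_imp_le[of "int p" 2] by (auto simp: cong_iff_dvd_diff)
  have "inj_on ?f (?B \<times> Pow ?Q)"
  proof (rule inj_onI, clarsimp)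
    fix x I x' I'
    assume x: "x \<in> U" "[x ^ t = 1] (mod int n) \<or> [x ^ t = -1] (mod int n)"
      and x': "x' \<in> U" "[x' ^ t = 1] (mod int n) \<or> [x' ^ t = -1] (mod int n)"
      and I: "I \<subseteq> ?Q" "I' \<subseteq> ?Q" and eq: "x * Y I mod int n = x' * Y I' mod int n"
    have eqn: "[x * Y I = x' * Y I'] (mod int n)" using eq by (simp add: cong_def)
    define s :: "int \<Rightarrow> int" where "s z = (if [z ^ t = 1] (mod int n) then 1 else -1)" for z
    have s: "[x ^ t = s x] (mod int n)" "[x' ^ t = s x'] (mod int n)" "s z = 1 \<or> s z = -1" for z
      using x x' by (auto simp: s_def)
    define u :: "nat \<Rightarrow> nat set \<Rightarrow> int" where "u p J = (if p \<in> J then -1 else 1)" for p J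
    have key: "[s x * u p I = s x' * u p I'] (mod int p)" if p: "p \<in> ?P" for p
    proof -
      have pd: "int p dvd int n" using big[OF p] by simp
      have "[(x * Y I) ^ t = (x' * Y I') ^ t] (mod int p)"
        using eqn pd cong_pow cong_dvd_modulus by blast
      then have "[x ^ t * Y I ^ t = x' ^ t * Y I' ^ t] (mod int p)"
        by (simp add: power_mult_distrib)
      moreover have "[x ^ t * Y I ^ t = s x * u p I] (mod int p)"
        unfolding u_def using cong_dvd_modulus[OF s(1) pd] Y(2)[OF p] by (intro cong_mult)
      moreover have "[x' ^ t * Y I' ^ t = s x' * u p I'] (mod int p)"
        unfolding u_def using cong_dvd_modulus[OF s(2) pd] Y(2)[OF p] by (intro cong_mult)
      ultimately show ?thesis by (meson cong_sym cong_trans)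
    qed
    have "u p0 I = 1" "u p0 I' = 1" using I by (auto simp: u_def)
    with key[OF p0] have "[s x = s x'] (mod int p0)" by simp
    with ne[OF p0] s(3)[of x] s(3)[of x'] have ss: "s x = s x'" by metis
    have "p \<in> I \<longleftrightarrow> p \<in> I'" if p: "p \<in> ?P" for p
    proof -
      have "[s x * s x * u p I = s x * s x * u p I'] (mod int p)"
        using cong_scalar_left[OF key[OF p], of "s x"] ss by (simp add: mult.assoc)
      moreover have "s x * s x = 1" using s(3)[of x] by auto
      ultimately have "[u p I = u p I'] (mod int p)" by simp
      then show ?thesis using ne[OF p] by (simp add: u_def split: if_splits)
    qed
    then have II: "I = I'" using I by blast
    then have "[x = x'] (mod int n)"
      using eqn Y(1) by (simp add: cong_mult_rcancel)
    then have "x = x'"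
      using x(1) x'(1) by (auto simp: U_def cong_def)
    with II show "x = x' \<and> I = I'" by simp
  qed
  moreover have "?f ` (?B \<times> Pow ?Q) \<subseteq> U"
  proof (rule image_subsetI, clarify)
    fix x I assume "x \<in> U"
    then have c: "coprime (x * Y I) (int n)" using Y(1) by (simp add: U_def)
    then have "(x * Y I) mod int n \<noteq> 0" using \<open>n > 1\<close> 

      using coprime_common_divisor[of "x * Y I" "int n" "int n"] by (auto simp del: coprime_mult_left_iff)
    moreover have "(x * Y I) mod int n \<ge> 0" using \<open>n > 1\<close> by simp
    moreover have "(x * Y I) mod int n < int n" using \<open>n > 1\<close> by simp
    ultimately show "x * Y I mod int n \<in> U"
      using c unfolding U_def by simp
  qed
  moreover have "finite U" by (rule finite_subset[of _ "{0..int n}"]) (auto simp: U_def)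
  ultimately have "card (?B \<times> Pow ?Q) \<le> card U" using card_inj_on_le by blast
  then show ?thesis using p0 by (simp add: card_cartesian_product card_Pow)
qed

lemma miller_rabin_bad_density:
  fixes n :: nat
  assumes "odd n" "n > 1"
  shows "bad_density (miller_rabin_test n) * 2 ^ (card (prime_factors n) - 1) \<le> 1"
proof -
  interpret residues "int n" "residue_ring (int n)"
    by (rule residues.intro) (use assms in auto)
  let ?R = "residue_ring (int n)"
  let ?U = "{x::int. 0 < x \<and> x < int n \<and> coprime x (int n)}"
  have pow: "x [^]\<^bsub>?R\<^esub> (t::nat) = x ^ t mod int n" if "x \<in> ?U" for x t
    using pow_cong[of x t] that by simp
  have n1: "n - 1 \<noteq> 0" using assms by simp
  obtain m where m: "n - 1 = 2 ^ multiplicity 2 (n - 1) * m" "\<not> 2 dvd m"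
    using multiplicity_decompose'[of "n - 1" 2] n1 by auto
  define k where "k = multiplicity 2 (n - 1)"
  have mk: "odd m" "n - 1 = m * 2 ^ k" using m by (auto simp: k_def mult.commute)
  have "k \<noteq> 0" using mk assms by (cases "k = 0") auto
  \<comment> \<open>The fixed exponent is \<open>m * 2 ^ j\<close> with \<open>j\<close> maximal. If
    a bad witness reaches -1 at \<open>i\<close>, maximality gives \<open>i \<le> j\<close>, and the
    remaining \<open>j - i\<close> squarings lead to 1 or leave -1.\<close>
  let ?hit = "\<lambda>j. j < k \<and> (\<exists>x::int. [x ^ (m * 2 ^ j) = -1] (mod int n))"
  \<comment> \<open>-1 is its own \<open>m\<close>-th power because \<open>m\<close> is odd.\<close>
  have "?hit 0" using \<open>k \<noteq> 0\<close> mk(1) by (auto intro!: exI[of _ "-1"])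
  define j where "j = Greatest ?hit"
  have hit: "?hit j" unfolding j_def by (rule GreatestI_nat[of ?hit 0 k]) (use \<open>?hit 0\<close> in auto)
  have max: "i \<le> j" if "?hit i" for i
    unfolding j_def using that by (intro Greatest_le_nat[of _ _ k]) auto
  from hit obtain w :: int where w: "[w ^ (m * 2 ^ j) = -1] (mod int n)" by blast
  let ?t = "m * 2 ^ j"
  have t0: "?t \<noteq> 0" using mk(1) by (auto intro: ccontr)
  have sub: "bad_witnesses (miller_rabin_test n)
    \<subseteq> {x\<in>?U. [x ^ ?t = 1] (mod int n) \<or> [x ^ ?t = -1] (mod int n)}"
  proof
    fix x assume "x \<in> bad_witnesses (miller_rabin_test n)"
    then obtain m' k' where x: "x \<in> ?U" and mk': "odd m'" "n - 1 = m' * 2 ^ k'"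
      and y: "x [^]\<^bsub>?R\<^esub> m' = \<one>\<^bsub>?R\<^esub> \<or> (\<exists>i<k'. x [^]\<^bsub>?R\<^esub> (m' * 2 ^ i) = \<ominus>\<^bsub>?R\<^esub> \<one>\<^bsub>?R\<^esub>)"
      unfolding bad_witnesses_def miller_rabin_test_def Let_def res_units_eq by auto
    \<comment> \<open>The test quantifies over decompositions of \<open>n - 1\<close>; the one
      supplied by the witness has to be identified with the fixed one.\<close>
    have "m' = m" "k' = k" using odd_part_unique[of m' m k' k] mk mk' by auto
    with y x have y: "[x ^ m = 1] (mod int n) \<or> (\<exists>i<k. [x ^ (m * 2 ^ i) = -1] (mod int n))"
      by (simp add: pow res_one_eq res_neg_eq cong_def one_cong)
    have "[x ^ ?t = 1] (mod int n) \<or> [x ^ ?t = -1] (mod int n)"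
      using y
    proof
      assume "[x ^ m = 1] (mod int n)"
      then have "[(x ^ m) ^ (2 ^ j) = 1 ^ (2 ^ j)] (mod int n)" by (rule cong_pow)
      then show ?thesis by (simp add: power_mult)
    next
      assume "\<exists>i<k. [x ^ (m * 2 ^ i) = -1] (mod int n)"
      then obtain i where i: "i < k" "[x ^ (m * 2 ^ i) = -1] (mod int n)" by blast
      then have ij: "i \<le> j" using max by blast
      then have "j = i + (j - i)" by simp
      have "[(x ^ (m * 2 ^ i)) ^ (2 ^ (j - i)) = (-1) ^ (2 ^ (j - i))] (mod int n)"
        using i by (intro cong_pow)
      also have "(x ^ (m * 2 ^ i)) ^ (2 ^ (j - i)) = x ^ ?t"
        using ij by (simp flip: power_mult power_add add: mult.assoc)
      finally show ?thesis
        by (cases "i < j") (use ij in \<open>auto simp: uminus_power_if\<close>)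
    qed
    with x show "x \<in> {x\<in>?U. [x ^ ?t = 1] (mod int n) \<or> [x ^ ?t = -1] (mod int n)}" by simp
  qed
  have fin: "finite ?U" by (rule finite_subset[of _ "{0..int n}"]) auto
  let ?c = "card (prime_factors n) - 1"
  have "card (bad_witnesses (miller_rabin_test n)) * 2 ^ ?c
    \<le> card {x\<in>?U. [x ^ ?t = 1] (mod int n) \<or> [x ^ ?t = -1] (mod int n)} * 2 ^ ?c"
    using sub fin by (intro mult_right_mono card_mono) (auto intro: finite_subset[OF _ fin])
  also have "\<dots> \<le> card ?U"
    by (rule card_power_eq_pm1) (use assms t0 w in auto)
  finally have "real (card (bad_witnesses (miller_rabin_test n)) * 2 ^ ?c) \<le> real (card ?U)"
    by (simp only: of_nat_le_iff)
  moreover have "witnesses (miller_rabin_test n) = ?U"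
    by (simp add: miller_rabin_test_def Let_def res_units_eq)
  moreover have "card ?U > 0"
    using fin assms by (auto simp: card_gt_0_iff intro!: exI[of _ 1])
  ultimately show ?thesis unfolding bad_density_def by (simp add: field_simps)
qed

section \<open>Rings with integer scalars and finite fields\<close>

text \<open>The homomorphism from the integers, characterised by its laws so that one development
  serves both the scalars of the algebra, reduced modulo \<open>n\<close>, and their images in a
  residue field.\<close>

locale int_cring = cring R for R (structure) +
  fixes \<iota> :: "int \<Rightarrow> 'a"
  assumes iota_closed [simp, intro]: "\<iota> k \<in> carrier R"
    and iota_add: "\<iota> (k + l) = \<iota> k \<oplus> \<iota> l"
    and iota_mult: "\<iota> (k * l) = \<iota> k \<otimes> \<iota> l"
    and iota_one [simp]: "\<iota> 1 = \<one>"
begin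

lemma iota_zero [simp]: "\<iota> 0 = \<zero>"
  using iota_add[of 0 0] by (metis add.l_cancel_one iota_closed add.inv_unique' add_0_right)

lemma iota_diff: "\<iota> (k - l) = \<iota> k \<ominus> \<iota> l"
proof -
  have "\<iota> (k - l) \<oplus> \<iota> l = \<iota> k" by (simp flip: iota_add)
  then show ?thesis by (metis add.inv_solve_right' iota_closed minus_eq)
qed

lemma iota_power: "\<iota> (k ^ i) = \<iota> k [^] i"
  by (induction i) (simp_all add: iota_mult m_comm)

lemma binomial_ring:
  assumes [simp]: "x \<in> carrier R" "y \<in> carrier R"
  shows "(x \<oplus> y) [^] N = (\<Oplus>k\<in>{..N}. \<iota> (int (N choose k)) \<otimes> (x [^] k \<otimes> y [^] (N - k)))"
proof (induction N)
  case (Suc N)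
  let ?t = "\<lambda>N k. \<iota> (int (N choose k)) \<otimes> (x [^] k \<otimes> y [^] (N - k))"
  have "(\<Oplus>k\<in>{..Suc N}. ?t (Suc N) k)
    = (\<Oplus>k\<in>{..N}. ?t (Suc N) (Suc k)) \<oplus> ?t (Suc N) 0"
    by (rule finsum_Suc2) auto
  also have "(\<Oplus>k\<in>{..N}. ?t (Suc N) (Suc k))
    = (\<Oplus>k\<in>{..N}. x \<otimes> ?t N k \<oplus> (\<iota> (int (N choose Suc k)) \<otimes> (x [^] Suc k \<otimes> y [^] (N - k))))"
    by (rule finsum_cong') (auto simp: iota_add l_distr r_distr m_ac)
  also have "\<dots> = (\<Oplus>k\<in>{..N}. x \<otimes> ?t N k)
     \<oplus> (\<Oplus>k\<in>{..N}. \<iota> (int (N choose Suc k)) \<otimes> (x [^] Suc k \<otimes> y [^] (N - k)))"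
    by (rule finsum_addf) auto
  also have "(\<Oplus>k\<in>{..N}. x \<otimes> ?t N k) = x \<otimes> (\<Oplus>k\<in>{..N}. ?t N k)"
    by (rule finsum_rdistr[symmetric]) auto
  also have "\<dots> = x \<otimes> (x \<oplus> y) [^] N" by (simp add: Suc.IH)
  finally have 1: "(\<Oplus>k\<in>{..Suc N}. ?t (Suc N) k) = x \<otimes> (x \<oplus> y) [^] N \<oplus>
     ((\<Oplus>k\<in>{..N}. \<iota> (int (N choose Suc k)) \<otimes> (x [^] Suc k \<otimes> y [^] (N - k))) \<oplus> y [^] Suc N)"
    by (simp add: a_assoc finsum_closed)
  have "(\<Oplus>k\<in>{..Suc N}. \<iota> (int (N choose k)) \<otimes> (x [^] k \<otimes> y [^] (Suc N - k)))
    = (\<Oplus>k\<in>{..N}. \<iota> (int (N choose Suc k)) \<otimes> (x [^] Suc k \<otimes> y [^] (N - k))) \<oplus> y [^] Suc N"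
    by (subst finsum_Suc2) auto
  moreover have "(\<Oplus>k\<in>{..Suc N}. \<iota> (int (N choose k)) \<otimes> (x [^] k \<otimes> y [^] (Suc N - k)))
    = (\<Oplus>k\<in>{..N}. \<iota> (int (N choose k)) \<otimes> (x [^] k \<otimes> y [^] (Suc N - k)))"
    by (subst finsum_Suc) (auto simp: binomial_eq_0)
  moreover have "\<dots> = (\<Oplus>k\<in>{..N}. y \<otimes> ?t N k)"
    by (rule finsum_cong') (auto simp: Suc_diff_le m_ac)
  moreover have "\<dots> = y \<otimes> (\<Oplus>k\<in>{..N}. ?t N k)"
    by (rule finsum_rdistr[symmetric]) auto
  ultimately have "(\<Oplus>k\<in>{..N}. \<iota> (int (N choose Suc k)) \<otimes> (x [^] Suc k \<otimes> y [^] (N - k))) \<oplus> y [^] Suc N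
    = y \<otimes> (x \<oplus> y) [^] N" using Suc.IH by simp
  with 1 have "(\<Oplus>k\<in>{..Suc N}. ?t (Suc N) k) = x \<otimes> (x \<oplus> y) [^] N \<oplus> y \<otimes> (x \<oplus> y) [^] N" by simp
  also have "\<dots> = (x \<oplus> y) [^] Suc N" by (simp add: l_distr m_comm)
  finally show ?case by simp
qed simp

lemma add_power_prime:
  assumes p: "Factorial_Ring.prime (p::nat)" "\<iota> (int p) = \<zero>"
    and [simp]: "x \<in> carrier R" "y \<in> carrier R"
  shows "(x \<oplus> y) [^] p = x [^] p \<oplus> y [^] p"
proof -
  obtain N where N: "p = Suc N" using prime_gt_0_nat[OF p(1)] gr0_implies_Suc by blast
  let ?t = "\<lambda>k. \<iota> (int (p choose k)) \<otimes> (x [^] k \<otimes> y [^] (p - k))"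
  have 0: "?t (Suc i) = \<zero>" if "i < N" for i
  proof -
    have "p dvd p choose Suc i"
      using that N p(1) by (intro dvd_choose_prime) auto
    then obtain c where "p choose Suc i = p * c" by blast
    then show ?thesis using p(2) by (simp add: iota_mult)
  qed
  have "(x \<oplus> y) [^] p = (\<Oplus>k\<in>{..Suc N}. ?t k)" using N by (simp only: binomial_ring[OF assms(3,4)])
  also have "\<dots> = ?t (Suc N) \<oplus> (\<Oplus>k\<in>{..N}. ?t k)" by (rule finsum_Suc) auto
  also have "?t (Suc N) = x [^] p" using N by simp
  also have "(\<Oplus>k\<in>{..N}. ?t k) = y [^] p"
  proof (cases N)
    case (Suc N')
    have "(\<Oplus>k\<in>{..Suc N'}. ?t k) = (\<Oplus>k\<in>{..N'}. ?t (Suc k)) \<oplus> ?t 0"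
      by (rule finsum_Suc2) auto
    also have "(\<Oplus>k\<in>{..N'}. ?t (Suc k)) = (\<Oplus>k\<in>{..N'}. \<zero>)"
      using 0 Suc by (intro finsum_cong') auto
    finally show ?thesis using Suc by simp
  qed simp
  finally show ?thesis .
qed

lemma add_pow_eq_iota:
  "x \<in> carrier R \<Longrightarrow> x [^]\<^bsub>add_monoid R\<^esub> (k::nat) = \<iota> (int k) \<otimes> x"
  by (induction k) (simp_all add: iota_add l_distr a_comm)

text \<open>A Taylor expansion whose remainder is a multiple of the square of \<open>c\<close>.
  Where \<open>\<iota> (int N)\<close> vanishes, the linear term drops out and \<open>N\<close>-th
  powers contract differences quadratically.\<close>

lemma pow_add_expand:
  assumes c: "c \<in> carrier R" and y: "y \<in> carrier R"
  shows "\<exists>z\<in>carrier R. (y \<oplus> c) [^] N = y [^] N \<oplus> c \<otimes> (\<iota> (int N) \<otimes> y [^] (N - 1) \<oplus> c \<otimes> z)"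
proof (induction N)
  case 0
  show ?case using c by (intro bexI[of _ \<zero>]) simp_all
next
  case (Suc N)
  then obtain z where z: "z \<in> carrier R"
    "(y \<oplus> c) [^] N = y [^] N \<oplus> c \<otimes> (\<iota> (int N) \<otimes> y [^] (N - 1) \<oplus> c \<otimes> z)"
    by blast
  define Y where "Y = y [^] (N - 1)"
  define Z where "Z = y [^] N"
  define I where "I = \<iota> (int N)"
  have Y: "Y \<in> carrier R" "Z \<in> carrier R" "I \<in> carrier R" using y by (auto simp: Y_def Z_def I_def)
  \<comment> \<open>For \<open>N = 0\<close> the truncated exponent \<open>N - 1\<close> is
    harmless, since its coefficient is 0.\<close>
  have YZ: "I \<otimes> (Y \<otimes> y) = I \<otimes> Z"
    using y by (cases N) (simp_all add: Y_def Z_def I_def)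
  have "(y \<oplus> c) [^] Suc N = (Z \<oplus> c \<otimes> (I \<otimes> Y \<oplus> c \<otimes> z)) \<otimes> (y \<oplus> c)"
    using z by (simp add: Y_def Z_def I_def)
  also have "\<dots> = Z \<otimes> y \<oplus> c \<otimes> ((I \<otimes> (Y \<otimes> y) \<oplus> Z) \<oplus> c \<otimes> (z \<otimes> y \<oplus> I \<otimes> Y \<oplus> c \<otimes> z))"
    using z(1) c y Y by algebra
  also have "I \<otimes> (Y \<otimes> y) \<oplus> Z = \<iota> (int (Suc N)) \<otimes> Z"
    unfolding YZ using Y by (simp add: I_def iota_add l_distr a_comm)
  finally have "(y \<oplus> c) [^] Suc N = y [^] Suc N \<oplus> c \<otimes> (\<iota> (int (Suc N)) \<otimes> y [^] (Suc N - 1)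
       \<oplus> c \<otimes> (z \<otimes> y \<oplus> I \<otimes> Y \<oplus> c \<otimes> z))" by (simp add: Z_def)
  moreover have "z \<otimes> y \<oplus> I \<otimes> Y \<oplus> c \<otimes> z \<in> carrier R" using z(1) c y Y by simp
  ultimately show ?case by blast
qed

end

text \<open>Polynomials are represented by their coefficient functions.\<close>

definition mult_linear :: "('a, 'b) ring_scheme \<Rightarrow> 'a \<Rightarrow> (nat \<Rightarrow> 'a) \<Rightarrow> nat \<Rightarrow> 'a" where
  "mult_linear R a c k = (case k of 0 \<Rightarrow> \<zero>\<^bsub>R\<^esub> | Suc l \<Rightarrow> c l) \<ominus>\<^bsub>R\<^esub> a \<otimes>\<^bsub>R\<^esub> c k"

text \<open>The coefficients of the product of \<open>X - a\<close> over the list. A list is used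
  because the conjugates of an element of a proper subfield repeat, and Frobenius rotates
  them.\<close>

definition root_coeffs :: "('a, 'b) ring_scheme \<Rightarrow> 'a list \<Rightarrow> nat \<Rightarrow> 'a" where
  "root_coeffs R as = foldr (mult_linear R) as (\<lambda>k. if k = 0 then \<one>\<^bsub>R\<^esub> else \<zero>\<^bsub>R\<^esub>)"

definition root_prod :: "('a, 'b) ring_scheme \<Rightarrow> 'a list \<Rightarrow> 'a \<Rightarrow> 'a" where
  "root_prod R as u = foldr (\<lambda>a r. (u \<ominus>\<^bsub>R\<^esub> a) \<otimes>\<^bsub>R\<^esub> r) as \<one>\<^bsub>R\<^esub>"

context cring
begin

lemma root_coeffs_Nil: "root_coeffs R [] = (\<lambda>k. if k = 0 then \<one> else \<zero>)"
  and root_coeffs_Cons: "root_coeffs R (a # as) = mult_linear R a (root_coeffs R as)"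
  by (simp_all add: root_coeffs_def)

lemma root_coeffs_closed:
  "set as \<subseteq> carrier R \<Longrightarrow> root_coeffs R as k \<in> carrier R"
  by (induction as arbitrary: k) (auto simp: root_coeffs_Nil root_coeffs_Cons mult_linear_def split: nat.split)

lemma root_coeffs_degree:
  "set as \<subseteq> carrier R \<Longrightarrow> k > length as \<Longrightarrow> root_coeffs R as k = \<zero>"
  by (induction as arbitrary: k)
    (auto simp: root_coeffs_Nil root_coeffs_Cons mult_linear_def a_minus_def split: nat.split)

lemma root_prod_closed: "set as \<subseteq> carrier R \<Longrightarrow> u \<in> carrier R \<Longrightarrow> root_prod R as u \<in> carrier R"
  by (induction as) (auto simp: root_prod_def)

lemma mult_linear_commute:
  assumes "a \<in> carrier R" "b \<in> carrier R" "\<And>k. c k \<in> carrier R"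
  shows "mult_linear R a (mult_linear R b c) = mult_linear R b (mult_linear R a c)"
proof
  fix k
  have *: "c l \<in> carrier R" for l by fact
  show "mult_linear R a (mult_linear R b c) k = mult_linear R b (mult_linear R a c) k"
  proof (cases k)
    case 0
    then show ?thesis unfolding mult_linear_def using assms(1,2) *[of 0] by (simp, algebra)
  next
    case (Suc l)
    then show ?thesis unfolding mult_linear_def using assms(1,2) *[of l] *[of "Suc l"] *[of "l - 1"]
      by (cases l) (simp, algebra)+
  qed
qed

text \<open>Linear factors commute. Moving the last root to the front is the one permutation that
  Frobenius requires.\<close>

lemma root_coeffs_snoc:
  assumes "set as \<subseteq> carrier R" "a \<in> carrier R"
  shows "root_coeffs R (as @ [a]) = root_coeffs R (a # as)"
  using assms
  by (induction as) (auto simp: root_coeffs_Cons root_coeffs_closed intro: mult_linear_commute)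

text \<open>The product exhibits the roots, whereas the sum can be formed in any ring to which the
  coefficients lift; comparing two homomorphisms takes both.\<close>

lemma root_prod_eq:
  assumes "set as \<subseteq> carrier R" and [simp]: "u \<in> carrier R"
  shows "root_prod R as u = (\<Oplus>k\<in>{..length as}. root_coeffs R as k \<otimes> u [^] k)"
  using assms(1)
proof (induction as)
  case Nil
  show ?case by (simp add: root_prod_def root_coeffs_Nil)
next
  case (Cons a as)
  let ?c = "root_coeffs R as" and ?N = "length as"
  have a [simp]: "a \<in> carrier R" and as: "set as \<subseteq> carrier R" using Cons.prems by auto
  have c [simp]: "?c k \<in> carrier R" for k using as by (rule root_coeffs_closed)
  let ?s = "\<lambda>k. case k of 0 \<Rightarrow> \<zero> | Suc l \<Rightarrow> ?c l"
  have s [simp]: "?s k \<in> carrier R" for k by (simp split: nat.split)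
  have "(\<Oplus>k\<in>{..Suc ?N}. root_coeffs R (a # as) k \<otimes> u [^] k)
    = (\<Oplus>k\<in>{..Suc ?N}. ?s k \<otimes> u [^] k \<oplus> (\<ominus> a) \<otimes> (?c k \<otimes> u [^] k))"
  proof (rule finsum_cong')
    fix k
    show "root_coeffs R (a # as) k \<otimes> u [^] k = ?s k \<otimes> u [^] k \<oplus> (\<ominus> a) \<otimes> (?c k \<otimes> u [^] k)"
      unfolding root_coeffs_Cons mult_linear_def using s[of k]
      by (simp add: a_minus_def l_distr l_minus m_assoc)
  qed auto
  also have "\<dots> = (\<Oplus>k\<in>{..Suc ?N}. ?s k \<otimes> u [^] k) \<oplus> (\<Oplus>k\<in>{..Suc ?N}. (\<ominus> a) \<otimes> (?c k \<otimes> u [^] k))"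
    by (rule finsum_addf) auto
  also have "(\<Oplus>k\<in>{..Suc ?N}. (\<ominus> a) \<otimes> (?c k \<otimes> u [^] k)) = (\<ominus> a) \<otimes> (\<Oplus>k\<in>{..Suc ?N}. ?c k \<otimes> u [^] k)"
    by (rule finsum_rdistr[symmetric]) auto
  also have "(\<Oplus>k\<in>{..Suc ?N}. ?c k \<otimes> u [^] k) = root_prod R as u"
    using root_coeffs_degree[OF as, of "Suc ?N"] Cons.IH[OF as]
    by (subst finsum_Suc) (auto simp: finsum_closed)
  also have "(\<Oplus>k\<in>{..Suc ?N}. ?s k \<otimes> u [^] k) = (\<Oplus>k\<in>{..?N}. ?c k \<otimes> u [^] Suc k)"
    by (subst finsum_Suc2) (auto simp: finsum_closed)
  also have "\<dots> = (\<Oplus>k\<in>{..?N}. u \<otimes> (?c k \<otimes> u [^] k))"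
    by (rule finsum_cong') (auto simp: m_ac)
  also have "\<dots> = u \<otimes> (\<Oplus>k\<in>{..?N}. ?c k \<otimes> u [^] k)"
    by (rule finsum_rdistr[symmetric]) auto
  also have "\<dots> = u \<otimes> root_prod R as u" using Cons.IH[OF as] by simp
  also have "u \<otimes> root_prod R as u \<oplus> (\<ominus> a) \<otimes> root_prod R as u = root_prod R (a # as) u"
    using root_prod_closed[OF as, of u] by (simp add: root_prod_def a_minus_def l_distr)
  finally show ?case by simp
qed

end

lemma (in domain) root_prod_eq_zero_iff:
  assumes "set as \<subseteq> carrier R" "u \<in> carrier R"
  shows "root_prod R as u = \<zero> \<longleftrightarrow> u \<in> set as"
  using assms(1)
proof (induction as)
  case Nil
  then show ?case by (simp add: root_prod_def)
next
  case (Cons a as)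
  have "root_prod R (a # as) u = (u \<ominus> a) \<otimes> root_prod R as u" by (simp add: root_prod_def)
  moreover have "u \<ominus> a = \<zero> \<longleftrightarrow> u = a" using Cons.prems assms(2) by (simp add: r_right_minus_eq)
  ultimately show ?case using Cons assms(2) root_prod_closed[of as u] by (auto simp: integral_iff)
qed

section \<open>Finite fields of characteristic \<open>p\<close>: Frobenius and conjugates\<close>

locale finite_prime_field = field R + int_cring R \<iota> for R (structure) and \<iota> +
  fixes p :: nat
  assumes fin: "finite (carrier R)"
    and prime_p: "Factorial_Ring.prime p"
    and iota_p: "\<iota> (int p) = \<zero>"
begin

lemma iota_eq_zero_iff: "\<iota> k = \<zero> \<longleftrightarrow> int p dvd k"
proof
  assume "int p dvd k"
  then show "\<iota> k = \<zero>" using iota_p by (auto simp: iota_mult)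
next
  assume k: "\<iota> k = \<zero>"
  show "int p dvd k"
  proof (rule ccontr)
    assume "\<not> int p dvd k"
    then have "coprime (int p) k" using prime_p by (simp add: prime_imp_coprime)
    then obtain a b where "a * int p + b * k = 1" using bezout_int[of "int p" k] by auto
    then have "\<one> = \<iota> (a * int p + b * k)" by simp
    also have "\<dots> = \<zero>" using k iota_p by (simp only: iota_add iota_mult) simp
    finally show False by simp
  qed
qed

text \<open>A further prime \<open>r\<close> dividing the order would give, by Sylow, an additive
  subgroup of order \<open>r\<close>. It is killed by both \<open>r\<close> and \<open>p\<close>,
  hence by 1.\<close>

lemma card_carrier_prime_power: "\<exists>f>0. card (carrier R) = p ^ f"
proof -
  let ?q = "card (carrier R)"
  have q0: "?q \<noteq> 0" using fin zero_closed by auto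
  have A: "group (add_monoid R)" by (rule a_group)
  have pr: "r = p" if r: "Factorial_Ring.prime r" "r dvd ?q" for r :: nat
  proof (rule ccontr)
    assume "r \<noteq> p"
    then have "coprime r p" using r(1) prime_p by (simp add: primes_coprime)
    then have "coprime (int r) (int p)" by simp
    then obtain a b where ab: "a * int r + b * int p = 1" using bezout_int[of "int r" "int p"] by auto
    obtain m where m: "?q = r ^ 1 * m" using r(2) by auto
    have "\<exists>H. subgroup H (add_monoid R) \<and> card H = r ^ 1"
      using m fin by (intro sylow_thm[OF r(1) A]) (auto simp: order_def)
    then obtain H where H: "subgroup H (add_monoid R)" "card H = r" by auto
    have "x = \<zero>" if x: "x \<in> H" for x
    proof -
      interpret H: group "add_monoid R \<lparr>carrier := H\<rparr>"
        using group.subgroup_imp_group[OF A H(1)] .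
      have xR: "x \<in> carrier R" using subgroup.mem_carrier[OF H(1) x] by simp
      have "x [^]\<^bsub>add_monoid R \<lparr>carrier := H\<rparr>\<^esub> order (add_monoid R \<lparr>carrier := H\<rparr>) = \<zero>"
        using H.pow_order_eq_1[of x] x by simp
      then have "x [^]\<^bsub>add_monoid R\<^esub> r = \<zero>"
        using H(2) monoid.nat_pow_consistent[OF group.is_monoid[OF A], of x r H] by (simp add: order_def)
      then have "\<iota> (int r) \<otimes> x = \<zero>" using add_pow_eq_iota[OF xR] by simp
      then have "\<iota> (a * int r + b * int p) \<otimes> x = \<zero>"
        using xR iota_p by (simp only: iota_add iota_mult) (simp add: m_assoc l_distr)
      then show ?thesis using ab xR by simp
    qed
    then have "H \<subseteq> {\<zero>}" by auto
    then have "card H \<le> 1" using card_mono[of "{\<zero>}" H] by simp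
    then show False using H(2) prime_gt_1_nat[OF r(1)] by simp
  qed
  obtain m where m: "?q = p ^ multiplicity p ?q * m" "\<not> p dvd m"
    using multiplicity_decompose'[of ?q p] q0 prime_p by (metis not_prime_unit)
  have "m = 1"
  proof (rule ccontr)
    assume "m \<noteq> 1"
    then obtain r where "Factorial_Ring.prime r" "r dvd m" using prime_factor_nat by blast
    moreover from this have "r dvd ?q" using m(1) by (metis dvd_mult)
    ultimately show False using pr m(2) by blast
  qed
  moreover have "?q \<noteq> 1"
  proof
    assume "?q = 1"
    then obtain x where "carrier R = {x}" using card_1_singletonE by blast
    then show False using zero_closed one_closed one_not_zero by auto
  qed
  ultimately show ?thesis
    using m(1) by (intro exI[of _ "multiplicity p ?q"]) (auto intro!: Nat.gr0I)
qed

lemma pow_card: 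
  assumes "x \<in> carrier R" shows "x [^] card (carrier R) = x"
proof (cases "x = \<zero>")
  case True
  have "card (carrier R) \<noteq> 0" using fin zero_closed by auto
  with True show ?thesis by (simp add: nat_pow_zero)
next
  case False
  interpret M: group "Multiplicative_Group.mult_of R" by (rule field_mult_group)
  have "x [^]\<^bsub>Multiplicative_Group.mult_of R\<^esub> order (Multiplicative_Group.mult_of R) = \<one>"
    using M.pow_order_eq_1[of x] assms False
    by (simp add: Multiplicative_Group.carrier_mult_of)
  then have "x [^] (card (carrier R) - 1) = \<one>"
    by (simp add: Multiplicative_Group.nat_pow_mult_of Multiplicative_Group.carrier_mult_of order_def fin)
  moreover have "card (carrier R) = Suc (card (carrier R) - 1)"
    using fin zero_closed by (metis Suc_pred' card_gt_0_iff empty_iff)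
  ultimately show ?thesis using assms by (metis l_one nat_pow_Suc)
qed

text \<open>By Fermat the images of 0 up to \<open>p - 1\<close> are \<open>p\<close> distinct roots
  of \<open>X ^ p - X\<close>, which leaves no room for another root.\<close>

lemma pow_p_fixed_imp_iota:
  assumes x: "x \<in> carrier R" "x [^] p = x"
  shows "\<exists>k. x = \<iota> k"
proof -
  let ?F = "{x \<in> carrier R. x [^] p = x}" and ?I = "\<iota> ` {0..<int p}"
  have p1: "p > 1" using prime_p by (rule prime_gt_1_nat)
  have "?F \<subseteq> insert \<zero> {x \<in> carrier R. x [^] (p - 1) = \<one>}"
  proof
    fix x assume x: "x \<in> ?F"
    have "x \<otimes> x [^] (p - 1) = x \<otimes> \<one>"
      using x p1 nat_pow_Suc2[of x "p - 1"] by simp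
    then show "x \<in> insert \<zero> {x \<in> carrier R. x [^] (p - 1) = \<one>}"
      using x m_lcancel[of x "x [^] (p - 1)" \<one>] by auto
  qed
  then have "card ?F \<le> card (insert \<zero> {x \<in> carrier R. x [^] (p - 1) = \<one>})"
    by (rule card_mono[rotated]) (use fin in auto)
  also have "\<dots> \<le> Suc (card {x \<in> carrier R. x [^] (p - 1) = \<one>})"
    by (rule card_insert_le_m1) auto
  also have "\<dots> \<le> Suc (p - 1)"
    using num_roots_le_deg[OF fin, of "p - 1"] p1 by simp
  also have "\<dots> = p" using p1 by simp
  finally have le: "card ?F \<le> p" .
  have "inj_on \<iota> {0..<int p}"
  proof (rule inj_onI)
    fix i j assume ij: "i \<in> {0..<int p}" "j \<in> {0..<int p}" "\<iota> i = \<iota> j"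
    then have "\<iota> (i - j) = \<zero>" by (simp add: iota_diff r_right_minus_eq)
    then have "[i = j] (mod int p)" using iota_eq_zero_iff cong_iff_dvd_diff by blast
    then show "i = j" using ij by (auto simp: cong_def)
  qed
  then have "card ?I = p" by (simp add: card_image)
  moreover have "?I \<subseteq> ?F"
  proof safe
    fix i :: int assume "i \<in> {0..<int p}"
    then obtain j where i: "i = int j" by (metis atLeastLessThan_iff nonneg_int_cases)
    have "[i ^ p = i] (mod int p)"
    proof (cases "int p dvd i")
      case True
      then show ?thesis using p1 by (auto simp: cong_def mod_eq_0_iff_dvd dvd_power_same dvd_trans[of _ i])
    next
      case False
      then have "[i ^ (p - 1) * i = 1 * i] (mod int p)" 
        using fermat_theorem[OF prime_p, of j] i by (intro cong_mult) (simp_all flip: cong_int_iff)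
      then show ?thesis using p1 power_minus_mult[of p i] by simp
    qed
    then have "\<iota> (i ^ p - i) = \<zero>" using iota_eq_zero_iff cong_iff_dvd_diff by blast
    then show "\<iota> i [^] p = \<iota> i" by (simp add: iota_diff iota_power r_right_minus_eq)
  qed auto
  ultimately have "?I = ?F" using le fin by (intro card_seteq) auto
  with x show ?thesis by blast
qed

lemma root_coeffs_pow_p:
  assumes "set as \<subseteq> carrier R"
  shows "root_coeffs R as k [^] p = root_coeffs R (map (\<lambda>a. a [^] p) as) k"
  using assms
proof (induction as arbitrary: k)
  case Nil
  then show ?case using prime_gt_0_nat[OF prime_p] by (simp add: root_coeffs_Nil nat_pow_zero)
next
  case (Cons a as)
  have minus: "(x \<ominus> y) [^] p = x [^] p \<ominus> y [^] p" if xy: "x \<in> carrier R" "y \<in> carrier R" for x y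
  proof -
    have "x [^] p = ((x \<ominus> y) \<oplus> y) [^] p" using xy by (simp add: minus_eq a_assoc l_neg)
    also have "\<dots> = (x \<ominus> y) [^] p \<oplus> y [^] p"
      using xy add_power_prime[OF prime_p iota_p] by simp
    finally show ?thesis using xy by (simp add: minus_eq a_assoc r_neg)
  qed
  have z: "\<zero> [^] p = \<zero>" using prime_gt_0_nat[OF prime_p] by (simp add: nat_pow_zero)
  have c: "root_coeffs R as l \<in> carrier R" for l using Cons.prems by (simp add: root_coeffs_closed)
  show ?case
    using Cons.prems c by (cases k)
      (simp_all add: root_coeffs_Cons mult_linear_def minus z nat_pow_distrib Cons.IH)
qed

text \<open>Frobenius rotates the list of conjugates, hence fixes the coefficients.\<close>

lemma conjugates_root_coeffs_integral:
  assumes f: "card (carrier R) = p ^ f" "f > 0" and z: "z \<in> carrier R"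
  shows "\<exists>c. root_coeffs R (map (\<lambda>i. z [^] (p ^ i)) [0..<f]) k = \<iota> c"
proof (rule pow_p_fixed_imp_iota)
  let ?as = "\<lambda>a b. map (\<lambda>i. z [^] (p ^ i)) [a..<b]"
  have cl: "set (?as a b) \<subseteq> carrier R" for a b using z by auto
  then show "root_coeffs R (?as 0 f) k \<in> carrier R" by (rule root_coeffs_closed)
  have "root_coeffs R (?as 0 f) k [^] p = root_coeffs R (map (\<lambda>a. a [^] p) (?as 0 f)) k"
    using cl by (rule root_coeffs_pow_p)
  also have "map (\<lambda>a. a [^] p) (?as 0 f) = map (\<lambda>i. z [^] (p ^ Suc i)) [0..<f]"
    using z by (simp add: nat_pow_pow mult.commute)
  also have "\<dots> = map (\<lambda>i. z [^] (p ^ i)) (map Suc [0..<f])" by simp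
  also have "\<dots> = ?as 1 (Suc f)" by (simp only: map_Suc_upt One_nat_def)
  also have "\<dots> = ?as 1 f @ [z]"
    using f z pow_card[OF z] by simp
  also have "root_coeffs R \<dots> k = root_coeffs R (z # ?as 1 f) k"
    using cl z by (simp only: root_coeffs_snoc)
  also have "z # ?as 1 f = ?as 0 f"
    using f(2) z by (simp add: upt_conv_Cons)
  finally show "root_coeffs R (?as 0 f) k [^] p = root_coeffs R (?as 0 f) k" .
qed

text \<open>The polynomial whose roots are the conjugates of \<open>\<pi> z\<close> has integer
  coefficients, so it can be evaluated at \<open>z\<close> in \<open>T\<close>. Its value
  \<open>s\<close> lies in the kernel of \<open>\<pi>\<close>, hence in that of
  \<open>\<psi>\<close>, and so \<open>\<psi> z\<close> is one of those conjugates. This is the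
  classical argument for the action of a decomposition group on its residue field; the exponent
  still depends on \<open>z\<close>.\<close>

lemma hom_eq_frobenius_power:
  assumes T: "int_cring T \<iota>\<^sub>T" and f: "card (carrier R) = p ^ f" "f > 0"
    and \<pi>: "\<pi> \<in> ring_hom T R" "\<And>k. \<pi> (\<iota>\<^sub>T k) = \<iota> k"
    and \<psi>: "\<psi> \<in> ring_hom T R" "\<And>k. \<psi> (\<iota>\<^sub>T k) = \<iota> k"
    and ker: "\<And>s. s \<in> carrier T \<Longrightarrow> \<pi> s = \<zero> \<Longrightarrow> \<psi> s = \<zero>"
    and z: "z \<in> carrier T"
  shows "\<exists>a<f. \<psi> z = \<pi> z [^] (p ^ a)"
proof -
  interpret T: int_cring T \<iota>\<^sub>T by fact
  let ?as = "map (\<lambda>i. \<pi> z [^] (p ^ i)) [0..<f]"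
  have pz: "\<pi> z \<in> carrier R" using \<pi> z by (auto simp: ring_hom_def)
  have qz: "\<psi> z \<in> carrier R" using \<psi> z by (auto simp: ring_hom_def)
  have cl: "set ?as \<subseteq> carrier R" using pz by auto
  obtain c where c: "\<And>k. root_coeffs R ?as k = \<iota> (c k)"
    using conjugates_root_coeffs_integral[OF f pz] by metis
  define s where "s = (\<Oplus>\<^bsub>T\<^esub>k\<in>{..f}. \<iota>\<^sub>T (c k) \<otimes>\<^bsub>T\<^esub> z [^]\<^bsub>T\<^esub> k)"
  have s: "s \<in> carrier T" using z by (auto simp: s_def intro!: T.finsum_closed)
  have eval: "\<phi> s = root_prod R ?as (\<phi> z)"
    if \<phi>: "\<phi> \<in> ring_hom T R" "\<And>k. \<phi> (\<iota>\<^sub>T k) = \<iota> k" for \<phi>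
  proof -
    interpret ring_hom_cring T R \<phi>
      by unfold_locales (fact \<phi>(1))
    have pw: "\<phi> (z [^]\<^bsub>T\<^esub> k) = \<phi> z [^] k" for k :: nat
      using z by (induction k) auto
    have "\<phi> s = (\<Oplus>k\<in>{..f}. (\<phi> \<circ> (\<lambda>k. \<iota>\<^sub>T (c k) \<otimes>\<^bsub>T\<^esub> z [^]\<^bsub>T\<^esub> k)) k)"
      unfolding s_def using z by (subst hom_finsum) (auto simp: o_def)
    also have "\<dots> = (\<Oplus>k\<in>{..f}. \<iota> (c k) \<otimes> \<phi> z [^] k)"
      using z by (intro finsum_cong') (auto simp: pw \<phi>)
    also have "\<dots> = root_prod R ?as (\<phi> z)"
      using z by (subst root_prod_eq[OF cl]) (auto simp: c)
    finally show ?thesis .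
  qed
  have "\<pi> z \<in> set ?as" using f(2) pz nat_pow_eone[OF pz] by force
  then have "\<pi> s = \<zero>" using eval[OF \<pi>] root_prod_eq_zero_iff[OF cl pz] by simp
  then have "root_prod R ?as (\<psi> z) = \<zero>" using ker[OF s] eval[OF \<psi>] by simp
  then have "\<psi> z \<in> set ?as" using root_prod_eq_zero_iff[OF cl qz] by simp
  then show ?thesis by auto
qed

text \<open>
  The solutions are \<open>(p ^ a - n)\<close>-th roots of unity, and, by applying Frobenius \<open>f - a\<close> more
  times, also \<open>(n * p ^ (f - a) - 1)\<close>-th roots of unity; the two bounds are multiplied.
\<close>

lemma card_frobenius_power_eq_pow:
  fixes n a :: nat
  assumes f: "card (carrier R) = p ^ f" and a: "a < f" and n: "n > 1" "n \<noteq> p ^ a"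
  shows "(card {x \<in> carrier R. x \<noteq> \<zero> \<and> x [^] (p ^ a) = x [^] n})\<^sup>2 \<le> n\<^sup>2 * card (carrier R)"
proof -
  let ?Z = "{x \<in> carrier R. x \<noteq> \<zero> \<and> x [^] (p ^ a) = x [^] n}"
  have p0: "p > 0" using prime_p by (rule prime_gt_0_nat)
  have sub: "x [^] (j - i) = \<one>" if "x \<in> carrier R" "x \<noteq> \<zero>" "x [^] i = x [^] j" "i < j" for x and i j :: nat
  proof -
    have "x [^] i \<otimes> x [^] (j - i) = x [^] j"
      using that(1,4) by (simp add: nat_pow_mult)
    also have "\<dots> = x [^] i \<otimes> \<one>" using that(1,3) by simp
    finally have "x [^] i \<otimes> x [^] (j - i) = x [^] i \<otimes> \<one>" .
    moreover have "x [^] i \<noteq> \<zero>"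
      using that(1,2) by (induction i) (simp_all add: integral_iff)
    ultimately show ?thesis using that(1) m_lcancel[of "x [^] i" "x [^] (j - i)" \<one>] by simp
  qed
  have bound: "card ?Z \<le> N" if "N > 0" "\<And>x. x \<in> ?Z \<Longrightarrow> x [^] N = \<one>" for N :: nat
  proof -
    have "card ?Z \<le> card {x \<in> carrier R. x [^] N = \<one>}"
      using that fin by (intro card_mono) auto
    also have "\<dots> \<le> N" using that fin by (intro num_roots_le_deg) auto
    finally show ?thesis .
  qed
  \<comment> \<open>Either of \<open>n\<close> and \<open>p ^ a\<close> may be the larger one; their
    difference is nonzero by assumption, and the product is a crude bound for it in both
    cases.\<close>
  have 1: "card ?Z \<le> n * p ^ a"
  proof (cases "n < p ^ a")
    case True
    then have "card ?Z \<le> p ^ a - n" by (intro bound) (auto intro!: sub)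
    also have "\<dots> \<le> 1 * p ^ a" by simp
    also have "\<dots> \<le> n * p ^ a" using n by (intro mult_right_mono) auto
    finally show ?thesis .
  next
    case False
    with n have "card ?Z \<le> n - p ^ a" by (intro bound) (auto intro!: sub)
    also have "\<dots> \<le> n * 1" by simp
    also have "\<dots> \<le> n * p ^ a" using p0 by (intro mult_left_mono) auto
    finally show ?thesis .
  qed
  have 2: "card ?Z \<le> n * p ^ (f - a)"
  proof -
    have N: "n * p ^ (f - a) > 1" using n p0 by (metis less_le_trans mult.right_neutral mult_le_mono2 one_le_power Suc_leI One_nat_def)
    have "card ?Z \<le> n * p ^ (f - a) - 1"
    proof (rule bound)
      show "n * p ^ (f - a) - 1 > 0" using N by simp
      fix x assume x: "x \<in> ?Z"
      have "x [^] (1::nat) = x [^] (p ^ a * p ^ (f - a))"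
        using x a pow_card[of x] f by (simp flip: power_add)
      also have "\<dots> = x [^] (n * p ^ (f - a))"
        using x by (simp flip: nat_pow_pow)
      finally show "x [^] (n * p ^ (f - a) - 1) = \<one>"
        using x N by (intro sub) auto
    qed
    then show ?thesis by simp
  qed
  have "(card ?Z)\<^sup>2 \<le> (n * p ^ a) * (n * p ^ (f - a))"
    unfolding power2_eq_square by (rule mult_mono[OF 1 2]) auto
  also have "\<dots> = n\<^sup>2 * p ^ (a + (f - a))" by (simp add: power2_eq_square power_add)
  also have "\<dots> = n\<^sup>2 * card (carrier R)" using a f by simp
  finally show ?thesis .
qed

lemma exists_generator:
  "\<exists>z\<in>carrier R. z \<noteq> \<zero> \<and> (\<forall>x\<in>carrier R. x \<noteq> \<zero> \<longrightarrow> (\<exists>i::nat. x = z [^] i))"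
proof -
  obtain a where "a \<in> carrier (Multiplicative_Group.mult_of R)" "carrier (Multiplicative_Group.mult_of R) = {a [^] i | i::nat. i \<in> UNIV}"
    using finite_field_mult_group_has_gen[OF fin] by blast
  then show ?thesis
    by (intro bexI[of _ a]) (auto simp: Multiplicative_Group.mult_of_simps)
qed

end

section \<open>A cyclic ring at a residue field\<close>

text \<open>
  \<open>\<pi>\<close> is the reduction modulo a maximal ideal above \<open>p\<close>, and \<open>\<iota> e\<close> is the idempotent that
  projects to the component of \<open>S\<close> of characteristic \<open>p ^ v\<close>.
\<close>

locale local_cyclic_ring = int_cring S \<iota> + K: field K
  for S (structure) and \<iota> and K :: "('b, 'c) ring_scheme" (structure) +
  fixes \<sigma> :: "'a \<Rightarrow> 'a" and d n p v :: nat and e :: int and \<pi> :: "'a \<Rightarrow> 'b"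
  assumes sigma_hom: "\<sigma> \<in> ring_hom S S"
    and sigma_iota: "\<sigma> (\<iota> k) = \<iota> k"
    and sigma_cyc: "x \<in> carrier S \<Longrightarrow> (\<sigma> ^^ d) x = x"
    and d_pos: "d > 0"
    and n_gt_1: "n > 1"
    and iota_eq_zero: "\<iota> k = \<zero>\<^bsub>S\<^esub> \<longleftrightarrow> int n dvd k"
    and sigma_fixed: "x \<in> carrier S \<Longrightarrow> \<sigma> x = x \<Longrightarrow> \<exists>k. x = \<iota> k"
    and pi_hom: "\<pi> \<in> ring_hom S K"
    and pi_surj: "\<pi> ` carrier S = carrier K"
    and pi_galois: "0 < i \<Longrightarrow> i < d \<Longrightarrow> \<exists>s\<in>carrier S. \<pi> ((\<sigma> ^^ i) s) \<noteq> \<pi> s"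
    and prime_p: "Factorial_Ring.prime p"
    and pi_p: "\<pi> (\<iota> (int p)) = \<zero>\<^bsub>K\<^esub>"
    and v_pos: "v > 0"
    and pv_dvd: "p ^ v dvd n"
    and e_pv: "[e = 1] (mod int (p ^ v))"
    and e_cofactor: "[e = 0] (mod int (n div p ^ v))"
begin

abbreviation E :: 'a where "E \<equiv> \<iota> e"

lemma p_dvd_pv: "int p dvd int (p ^ v)"
  using v_pos by (simp add: dvd_power)

lemma e_p: "[e = 1] (mod int p)"
  using e_pv p_dvd_pv by (rule cong_dvd_modulus)

lemma n_factorization: "int n = int (p ^ v) * int (n div p ^ v)"
  using pv_dvd by (metis dvd_mult_div_cancel of_nat_mult)

lemma n_dvd_iff: "int n dvd k \<longleftrightarrow> int (p ^ v) dvd k \<and> int (n div p ^ v) dvd k"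
proof -
  \<comment> \<open>Coprimality is encoded in \<open>e\<close>, which is 1 modulo one factor and
    divisible by the other.\<close>
  have "coprime (int (p ^ v)) (int (n div p ^ v))"
  proof -
    have "coprime e (int (p ^ v))"
      using e_pv by (metis cong_imp_coprime cong_sym coprime_1_left)
    moreover have "int (n div p ^ v) dvd e" using e_cofactor by (simp only: cong_0_iff)
    ultimately show ?thesis by (metis coprime_commute coprime_divisors dvd_refl)
  qed
  then have "int (p ^ v) * int (n div p ^ v) dvd k" if "int (p ^ v) dvd k" "int (n div p ^ v) dvd k"
    using that by (intro semiring_gcd_class.divides_mult)
  then show ?thesis
    unfolding n_factorization using dvd_mult_left dvd_mult_right by metis
qed

lemma n_dvd_e: "int n dvd (1 - e) * e"
  using e_pv e_cofactor
  by (auto simp: n_dvd_iff cong_iff_dvd_diff dvd_diff_commute)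

lemma E_orth [simp]: "(\<one> \<ominus> E) \<otimes> E = \<zero>"
proof -
  have "(\<one> \<ominus> E) \<otimes> E = \<iota> ((1 - e) * e)" by (simp add: iota_mult iota_diff)
  also have "\<dots> = \<zero>" using n_dvd_e by (simp only: iota_eq_zero)
  finally show ?thesis .
qed

sublocale sp: ring_hom_cring S S \<sigma>
  by unfold_locales (fact sigma_hom)

sublocale pi: ring_hom_cring S K \<pi>
  by unfold_locales (fact pi_hom)

lemma sp_hom: "(\<sigma> ^^ i) \<in> ring_hom S S"
proof (induction i)
  case 0
  show ?case by (auto simp: ring_hom_def)
next
  case (Suc i)
  then show ?case using sigma_hom by (auto simp: ring_hom_def Pi_iff)
qed

lemma sp_ring_hom_cring: "ring_hom_cring S S (\<sigma> ^^ i)"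
  by unfold_locales (fact sp_hom)

lemma sp_closed [simp]: "x \<in> carrier S \<Longrightarrow> (\<sigma> ^^ i) x \<in> carrier S"
  using ring_hom_closed[OF sp_hom] .
lemma sp_add [simp]: "x \<in> carrier S \<Longrightarrow> y \<in> carrier S \<Longrightarrow> (\<sigma> ^^ i) (x \<oplus> y) = (\<sigma> ^^ i) x \<oplus> (\<sigma> ^^ i) y"
  using ring_hom_add[OF sp_hom] .
lemma sp_mult [simp]: "x \<in> carrier S \<Longrightarrow> y \<in> carrier S \<Longrightarrow> (\<sigma> ^^ i) (x \<otimes> y) = (\<sigma> ^^ i) x \<otimes> (\<sigma> ^^ i) y"
  using ring_hom_mult[OF sp_hom] .
lemma sp_one [simp]: "(\<sigma> ^^ i) \<one> = \<one>"
  using ring_hom_one[OF sp_hom] .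
lemma sp_zero [simp]: "(\<sigma> ^^ i) \<zero> = \<zero>"
  using ring_hom_zero[OF sp_hom ring_axioms ring_axioms] .
lemma sp_minus [simp]: "x \<in> carrier S \<Longrightarrow> y \<in> carrier S \<Longrightarrow> (\<sigma> ^^ i) (x \<ominus> y) = (\<sigma> ^^ i) x \<ominus> (\<sigma> ^^ i) y"
proof -
  interpret ring_hom_cring S S "\<sigma> ^^ i" by (rule sp_ring_hom_cring)
  show "x \<in> carrier S \<Longrightarrow> y \<in> carrier S \<Longrightarrow> (\<sigma> ^^ i) (x \<ominus> y) = (\<sigma> ^^ i) x \<ominus> (\<sigma> ^^ i) y"
    by (simp add: minus_eq)
qed
lemma sp_pow: "x \<in> carrier S \<Longrightarrow> (\<sigma> ^^ i) (x [^] (k::nat)) = (\<sigma> ^^ i) x [^] k"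
  by (induction k) auto
lemma sp_iota [simp]: "(\<sigma> ^^ i) (\<iota> k) = \<iota> k"
  by (induction i) (auto simp: sigma_iota)
lemma sp_sp: "(\<sigma> ^^ i) ((\<sigma> ^^ j) x) = (\<sigma> ^^ (i + j)) x"
  by (simp add: funpow_add)
lemma sp_mult_d: "x \<in> carrier S \<Longrightarrow> (\<sigma> ^^ (d * k)) x = x"
  by (induction k) (auto simp: funpow_add sigma_cyc)
lemma sp_add_d: "x \<in> carrier S \<Longrightarrow> (\<sigma> ^^ (i + d)) x = (\<sigma> ^^ i) x"
  by (simp add: funpow_add sigma_cyc)

lemma pi_minus: "x \<in> carrier S \<Longrightarrow> y \<in> carrier S \<Longrightarrow> \<pi> (x \<ominus> y) = \<pi> x \<ominus>\<^bsub>K\<^esub> \<pi> y"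
  by (simp add: minus_eq K.minus_eq)
lemma pi_pow: "x \<in> carrier S \<Longrightarrow> \<pi> (x [^] (k::nat)) = \<pi> x [^]\<^bsub>K\<^esub> k"
  by (induction k) auto

lemma pi_iota_eq_zero: "int p dvd k \<Longrightarrow> \<pi> (\<iota> k) = \<zero>\<^bsub>K\<^esub>"
  using pi_p by (auto simp: iota_mult)

lemma pi_E [simp]: "\<pi> E = \<one>\<^bsub>K\<^esub>"
proof -
  have "\<pi> (\<iota> (e - 1)) = \<zero>\<^bsub>K\<^esub>"
    using e_p by (intro pi_iota_eq_zero) (simp add: cong_iff_dvd_diff)
  then show ?thesis by (simp add: iota_diff pi_minus)
qed

text \<open>\<open>loc x\<close> agrees with \<open>x\<close> on the component at \<open>p\<close> and with \<open>1\<close> on its complement.\<close>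

definition loc :: "'a \<Rightarrow> 'a" where "loc x = (\<one> \<ominus> E) \<oplus> E \<otimes> x"

lemma loc_closed [simp]: "x \<in> carrier S \<Longrightarrow> loc x \<in> carrier S"
  by (simp add: loc_def)

lemma pi_sp_loc [simp]: "x \<in> carrier S \<Longrightarrow> \<pi> ((\<sigma> ^^ i) (loc x)) = \<pi> ((\<sigma> ^^ i) x)"
  by (simp add: loc_def pi_minus)

lemma pi_loc [simp]: "x \<in> carrier S \<Longrightarrow> \<pi> (loc x) = \<pi> x"
  using pi_sp_loc[of x 0] by simp

lemma orth_loc: "x \<in> carrier S \<Longrightarrow> (\<one> \<ominus> E) \<otimes> (\<sigma> ^^ i) (loc x) = \<one> \<ominus> E"
proof -
  assume x: "x \<in> carrier S"
  define F where "F = \<one> \<ominus> E"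
  define y where "y = (\<sigma> ^^ i) x"
  have F: "F \<in> carrier S" "E \<in> carrier S" "y \<in> carrier S" "F \<otimes> E = \<zero>" "F = \<one> \<ominus> E" using x
    by (auto simp: F_def y_def)
  have "F \<otimes> F = F \<ominus> F \<otimes> E" using F(1,2) unfolding F(5) by algebra
  then have FF: "F \<otimes> F = F" using F by (simp add: minus_eq)
  have "F \<otimes> (\<sigma> ^^ i) (loc x) = F \<otimes> (F \<oplus> E \<otimes> y)"
    using x by (simp add: loc_def F_def y_def)
  also have "\<dots> = F \<otimes> F \<oplus> (F \<otimes> E) \<otimes> y" using F(1-3) by algebra
  also have "\<dots> = F" using F FF by simp
  finally show ?thesis by (simp add: F_def)
qed

text \<open>The norm of \<open>loc x\<close> is invariant, hence some \<open>\<iota> k\<close>.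
  Nonzero residues make \<open>k\<close> prime to \<open>p\<close>, and being 1 off the component
  makes \<open>k\<close> congruent to 1 modulo the cofactor. So \<open>k\<close> is invertible
  modulo \<open>n\<close>, and \<open>loc x\<close> divides a unit.\<close>

lemma loc_unit:
  assumes x: "x \<in> carrier S" and nz: "\<And>i. \<pi> ((\<sigma> ^^ i) x) \<noteq> \<zero>\<^bsub>K\<^esub>"
  shows "loc x \<in> Units S"
proof -
  let ?y = "loc x"
  define N where "N j = (\<Otimes>i\<in>{..<j}. (\<sigma> ^^ i) ?y)" for j
  \<comment> \<open>The shifted product is at once the image of \<open>N j\<close> under
    \<open>\<sigma>\<close> and the cofactor of \<open>loc x\<close> in \<open>N (Suc j)\<close>;
    for a full orbit this gives invariance of the norm and, later, the inverse.\<close>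
  define N1 where "N1 j = (\<Otimes>i\<in>{..<j}. (\<sigma> ^^ Suc i) ?y)" for j
  have y: "?y \<in> carrier S" using x by simp
  have N0: "N 0 = \<one>" and N1_0: "N1 0 = \<one>" by (simp_all add: N_def N1_def)
  have NS: "N (Suc j) = (\<sigma> ^^ j) ?y \<otimes> N j" for j
    unfolding N_def lessThan_Suc using y by (subst finprod_insert) auto
  have N1S: "N1 (Suc j) = (\<sigma> ^^ Suc j) ?y \<otimes> N1 j" for j
    unfolding N1_def lessThan_Suc using y sp_closed[of ?y "Suc _"] 
    by (subst finprod_insert) (auto simp del: funpow.simps)
  have Nc [simp]: "N j \<in> carrier S" for j by (induction j) (use y in \<open>auto simp: N0 NS\<close>)
  have N1c [simp]: "N1 j \<in> carrier S" for j
    by (induction j) (use y sp_closed[of ?y "Suc _"] in \<open>auto simp: N1_0 N1S simp del: funpow.simps\<close>)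
  have N_N1: "N (Suc j) = ?y \<otimes> N1 j" for j
  proof (induction j)
    case 0
    show ?case using y by (simp add: NS N0 N1_0)
  next
    case (Suc j)
    have "N (Suc (Suc j)) = (\<sigma> ^^ Suc j) ?y \<otimes> (?y \<otimes> N1 j)" using Suc NS by metis
    also have "\<dots> = ?y \<otimes> N1 (Suc j)"
      unfolding N1S using y N1c[of j] sp_closed[OF y, of "Suc j"] by (simp add: m_lcomm del: funpow.simps)
    finally show ?case .
  qed
  have sN: "\<sigma> (N j) = N1 j" for j
  proof (induction j)
    case (Suc j)
    then show ?case using y by (simp add: NS N1S)
  qed (simp add: N0 N1_0)
  obtain d' where d: "d = Suc d'" using d_pos gr0_implies_Suc by blast
  have "\<sigma> (N d) = N1 (Suc d')" using sN d by simp
  also have "\<dots> = ?y \<otimes> N1 d'" using N1S[of d'] sigma_cyc[OF y] d by (simp del: funpow.simps)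
  also have "\<dots> = N d" using N_N1 d by simp
  finally obtain k where k: "N d = \<iota> k" using sigma_fixed[of "N d"] by auto
  have "\<pi> (N j) \<noteq> \<zero>\<^bsub>K\<^esub>" for j
  proof (induction j)
    case (Suc j)
    then show ?case using nz[of j] x by (simp add: NS K.integral_iff)
  qed (simp add: N0)
  then have "\<not> int p dvd k" using k pi_iota_eq_zero by metis
  then have c1: "coprime k (int (p ^ v))"
    using prime_p by (simp add: coprime_commute[of k] prime_imp_coprime)
  \<comment> \<open>Every conjugate of \<open>loc x\<close> is 1 on the complement of the component,
    hence so is the norm.\<close>
  have "(\<one> \<ominus> E) \<otimes> N j = \<one> \<ominus> E" for j
  proof (induction j)
    case (Suc j)
    have "(\<one> \<ominus> E) \<otimes> N (Suc j) = ((\<one> \<ominus> E) \<otimes> (\<sigma> ^^ j) ?y) \<otimes> N j"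
      using y by (simp add: NS m_assoc)
    then show ?case using Suc orth_loc[OF x] by simp
  qed (simp add: N0)
  from this[of d] have "\<iota> ((1 - e) * k) = \<iota> (1 - e)" using k by (simp add: iota_mult iota_diff)
  then have "\<iota> ((1 - e) * k - (1 - e)) = \<zero>" by (simp add: iota_diff[of "(1 - e) * k"])
  then have "int (n div p ^ v) dvd (1 - e) * k - (1 - e)" using n_dvd_iff iota_eq_zero by blast
  moreover have "int (n div p ^ v) dvd e * (k - 1)" using e_cofactor by (simp add: cong_0_iff)
  ultimately have "int (n div p ^ v) dvd ((1 - e) * k - (1 - e)) + e * (k - 1)" by (rule dvd_add)
  then have "int (n div p ^ v) dvd k - 1" by (simp add: algebra_simps)
  then have c2: "coprime k (int (n div p ^ v))"
    by (metis cong_iff_dvd_diff cong_imp_coprime cong_sym coprime_1_left)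
  have "coprime k (int n)" unfolding n_factorization using c1 c2 by (simp only: coprime_mult_right_iff)
  then obtain a b where "a * k + b * int n = 1" using bezout_int[of k "int n"] by auto
  then have "\<iota> (a * k + b * int n) = \<one>" by simp
  moreover have "\<iota> (b * int n) = \<zero>" by (simp add: iota_eq_zero)
  ultimately have "\<iota> k \<otimes> \<iota> a = \<one>" by (simp add: iota_add iota_mult m_comm)
  then have "?y \<otimes> (N1 d' \<otimes> \<iota> a) = \<one>" using k N_N1[of d'] d y by (simp flip: m_assoc)
  then show ?thesis using y by (auto simp: Units_def m_comm intro!: bexI[of _ "N1 d' \<otimes> \<iota> a"])
qed

end

section \<open>The orbit of the kernel of \<open>\<pi>\<close> and interpolation of residues\<close>

context local_cyclic_ring
begin

text \<open>Membership of \<open>\<sigma> ^^ i\<close> in the decomposition group of the kernel of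
  \<open>\<pi>\<close>, phrased through residues.\<close>

definition stab :: "nat \<Rightarrow> bool" where
  "stab i \<longleftrightarrow> (\<forall>x\<in>carrier S. \<pi> ((\<sigma> ^^ i) x) = \<zero>\<^bsub>K\<^esub> \<longleftrightarrow> \<pi> x = \<zero>\<^bsub>K\<^esub>)"

text \<open>The number of maximal ideals in the orbit of the kernel of \<open>\<pi>\<close>.\<close>

definition g :: nat where "g = (LEAST i. 0 < i \<and> stab i)"

lemma stab_d: "stab d"
  by (simp add: stab_def sigma_cyc)

lemma stab_add: "stab i \<Longrightarrow> stab (i + j) \<longleftrightarrow> stab j"
  unfolding stab_def by (simp flip: sp_sp)

lemma g_pos: "g > 0" and stab_g: "stab g"
  using LeastI[of "\<lambda>i. 0 < i \<and> stab i" d] d_pos stab_d by (auto simp: g_def)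

lemma stab_mult_g: "stab (g * k)"
  by (induction k) (auto simp: stab_add[OF stab_g], simp add: stab_def)

lemma stab_iff: "stab i \<longleftrightarrow> g dvd i"
proof
  assume "stab i"
  then have "stab (g * (i div g) + i mod g)" by simp
  then have "stab (i mod g)" using stab_add[OF stab_mult_g] by blast
  moreover have "i mod g < g" using g_pos by simp
  ultimately have "i mod g = 0"
    using not_less_Least[of "i mod g" "\<lambda>i. 0 < i \<and> stab i"] by (auto simp: g_def)
  then show "g dvd i" by auto
qed (auto intro: stab_mult_g)

lemma g_dvd_d: "g dvd d"
  using stab_d stab_iff by blast

lemma g_le_d: "g \<le> d"
  using g_dvd_d d_pos by (rule dvd_imp_le)

text \<open>Only vanishing is periodic in \<open>i\<close>, not the residue itself:
  \<open>\<sigma> ^^ g\<close> may act nontrivially on the residue field.\<close>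

lemma pi_sp_eq_zero_mod_g:
  "x \<in> carrier S \<Longrightarrow> \<pi> ((\<sigma> ^^ i) x) = \<zero>\<^bsub>K\<^esub> \<longleftrightarrow> \<pi> ((\<sigma> ^^ (i mod g)) x) = \<zero>\<^bsub>K\<^esub>"
  using stab_mult_g[of "i div g"] sp_sp[of "g * (i div g)" "i mod g" x]
    sp_closed[of x "i mod g"] unfolding stab_def by (metis mult_div_mod_eq)

text \<open>Without a separator, vanishing after \<open>\<sigma> ^^ i\<close> would imply vanishing
  before it. Going once around the cycle, where \<open>\<sigma> ^^ (i * d)\<close> is the identity,
  turns this into an equivalence, so \<open>i\<close> would stabilise the kernel.\<close>

lemma exists_separator:
  assumes "\<not> g dvd i"
  shows "\<exists>x\<in>carrier S. \<pi> ((\<sigma> ^^ i) x) = \<zero>\<^bsub>K\<^esub> \<and> \<pi> x \<noteq> \<zero>\<^bsub>K\<^esub>"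
proof (rule ccontr)
  assume "\<not> ?thesis"
  then have *: "\<pi> x = \<zero>\<^bsub>K\<^esub>" if "x \<in> carrier S" "\<pi> ((\<sigma> ^^ i) x) = \<zero>\<^bsub>K\<^esub>" for x
    using that by blast
  have "\<pi> ((\<sigma> ^^ i) x) = \<zero>\<^bsub>K\<^esub>" if x: "x \<in> carrier S" "\<pi> x = \<zero>\<^bsub>K\<^esub>" for x
  proof -
    have down: "\<pi> ((\<sigma> ^^ (i * Suc k)) x) = \<zero>\<^bsub>K\<^esub> \<Longrightarrow> \<pi> ((\<sigma> ^^ i) x) = \<zero>\<^bsub>K\<^esub>" for k
    proof (induction k)
      case (Suc k)
      have "\<pi> ((\<sigma> ^^ i) ((\<sigma> ^^ (i * Suc k)) x)) = \<zero>\<^bsub>K\<^esub>"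
        unfolding sp_sp using Suc.prems by simp
      then show ?case using *[of "(\<sigma> ^^ (i * Suc k)) x"] x Suc.IH by simp
    qed simp
    obtain d' where "d = Suc d'" using d_pos gr0_implies_Suc by blast
    then have "\<pi> ((\<sigma> ^^ (i * Suc d')) x) = \<zero>\<^bsub>K\<^esub>"
      using sp_mult_d[OF x(1), of i] x(2) by (simp add: mult.commute)
    then show ?thesis by (rule down)
  qed
  with * have "stab i" unfolding stab_def by blast
  with assms stab_iff show False by blast
qed

text \<open>A product of separators handles the indices below \<open>g\<close>; periodicity of
  vanishing handles the rest.\<close>

lemma exists_local_unit:
  "\<exists>x\<in>carrier S. \<pi> x \<noteq> \<zero>\<^bsub>K\<^esub> \<and> (\<forall>i. \<not> g dvd i \<longrightarrow> \<pi> ((\<sigma> ^^ i) x) = \<zero>\<^bsub>K\<^esub>)"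
proof -
  have "\<exists>x\<in>carrier S. \<pi> x \<noteq> \<zero>\<^bsub>K\<^esub> \<and> (\<forall>i<j. \<not> g dvd i \<longrightarrow> \<pi> ((\<sigma> ^^ i) x) = \<zero>\<^bsub>K\<^esub>)" for j
  proof (induction j)
    case 0
    show ?case by (intro bexI[of _ \<one>]) auto
  next
    case (Suc j)
    then obtain x where x: "x \<in> carrier S" "\<pi> x \<noteq> \<zero>\<^bsub>K\<^esub>"
      "\<And>i. i < j \<Longrightarrow> \<not> g dvd i \<Longrightarrow> \<pi> ((\<sigma> ^^ i) x) = \<zero>\<^bsub>K\<^esub>" by blast
    show ?case
    proof (cases "g dvd j")
      case True
      then show ?thesis using x by (auto simp: less_Suc_eq)
    next
      case False
      then obtain y where y: "y \<in> carrier S" "\<pi> ((\<sigma> ^^ j) y) = \<zero>\<^bsub>K\<^esub>" "\<pi> y \<noteq> \<zero>\<^bsub>K\<^esub>"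
        using exists_separator by blast
      then show ?thesis using x
        by (intro bexI[of _ "x \<otimes> y"]) (auto simp: less_Suc_eq K.integral_iff)
    qed
  qed
  from this[of g] obtain x where x: "x \<in> carrier S" "\<pi> x \<noteq> \<zero>\<^bsub>K\<^esub>"
    "\<And>i. i < g \<Longrightarrow> \<not> g dvd i \<Longrightarrow> \<pi> ((\<sigma> ^^ i) x) = \<zero>\<^bsub>K\<^esub>" by blast
  have "\<pi> ((\<sigma> ^^ i) x) = \<zero>\<^bsub>K\<^esub>" if "\<not> g dvd i" for i
    using x(3)[of "i mod g"] that g_pos pi_sp_eq_zero_mod_g[OF x(1), of i]
    by (simp add: dvd_eq_mod_eq_0)
  with x show ?thesis by blast
qed

text \<open>The Chinese remainder theorem for the \<open>g\<close> conjugates of the kernel, carried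
  out inside a \<open>\<sigma>\<close>-stable ideal not contained in the kernel. This generality
  serves both the whole ring and annihilators of scalars.\<close>

lemma interpolation_in_ideal:
  assumes A: "A \<subseteq> carrier S" "\<zero> \<in> A" "\<And>x y. x \<in> A \<Longrightarrow> y \<in> A \<Longrightarrow> x \<oplus> y \<in> A"
    "\<And>x y. x \<in> A \<Longrightarrow> y \<in> carrier S \<Longrightarrow> y \<otimes> x \<in> A" "\<And>x. x \<in> A \<Longrightarrow> \<sigma> x \<in> A"
    and u: "u \<in> A" "\<pi> u \<noteq> \<zero>\<^bsub>K\<^esub>"
    and c: "\<And>i. i < g \<Longrightarrow> c i \<in> carrier K"
  shows "\<exists>t\<in>A. \<forall>i<g. \<pi> ((\<sigma> ^^ i) t) = c i"
proof -
  obtain y where y: "y \<in> carrier S" "\<pi> y \<noteq> \<zero>\<^bsub>K\<^esub>"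
    "\<And>i. \<not> g dvd i \<Longrightarrow> \<pi> ((\<sigma> ^^ i) y) = \<zero>\<^bsub>K\<^esub>" using exists_local_unit by blast
  have uS: "u \<in> carrier S" using A u by blast
  have spA: "(\<sigma> ^^ i) x \<in> A" if "x \<in> A" for x i using that A(5) by (induction i) auto
  have nz: "\<pi> (u \<otimes> y) \<noteq> \<zero>\<^bsub>K\<^esub>" using u y uS by (simp add: K.integral_iff)
  have "\<exists>t\<in>A. \<forall>i<g. \<pi> ((\<sigma> ^^ i) t) = (if i < m then c i else \<zero>\<^bsub>K\<^esub>)" if "m \<le> g" for m
    using that
  proof (induction m)
    case 0
    show ?case using A(2) by (intro bexI[of _ \<zero>]) auto
  next
    case (Suc m)
    then obtain t where t: "t \<in> A" "\<And>i. i < g \<Longrightarrow> \<pi> ((\<sigma> ^^ i) t) = (if i < m then c i else \<zero>\<^bsub>K\<^esub>)"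
      by auto
    have m: "m < g" using Suc.prems by simp
    have "c m \<otimes>\<^bsub>K\<^esub> inv\<^bsub>K\<^esub> (\<pi> (u \<otimes> y)) \<in> \<pi> ` carrier S"
      unfolding pi_surj using nz c[OF m] uS y(1) by (auto simp: K.field_Units)
    then obtain b where b: "b \<in> carrier S" "\<pi> b = c m \<otimes>\<^bsub>K\<^esub> inv\<^bsub>K\<^esub> (\<pi> (u \<otimes> y))" by auto
    define w where "w = (b \<otimes> y) \<otimes> u"
    have w: "w \<in> A" "w \<in> carrier S" using A u y b uS by (auto simp: w_def)
    have pw: "\<pi> w = c m"
    proof -
      have "\<pi> w = \<pi> b \<otimes>\<^bsub>K\<^esub> \<pi> (u \<otimes> y)" using b(1) y(1) uS
        by (simp only: w_def pi.hom_mult m_closed pi.hom_closed K.m_ac K.m_closed)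
      also have "\<dots> = c m"
        unfolding b(2) using nz c[OF m] uS y(1)
        by (subst K.m_assoc) (auto simp: K.field_Units K.Units_l_inv)
      finally show ?thesis .
    qed
    have pw0: "\<pi> ((\<sigma> ^^ i) w) = \<zero>\<^bsub>K\<^esub>" if "\<not> g dvd i" for i
      using y(3)[OF that] b y uS by (simp add: w_def)
    \<comment> \<open>\<open>d - m\<close> stands for \<open>-m\<close>: the shift moves the only
      nonzero residue of \<open>w\<close> among the first \<open>g\<close> from position 0 to
      position \<open>m\<close>, because \<open>g\<close> divides \<open>d\<close>.\<close>
    let ?t = "t \<oplus> (\<sigma> ^^ (d - m)) w"
    have "\<pi> ((\<sigma> ^^ i) ?t) = (if i < Suc m then c i else \<zero>\<^bsub>K\<^esub>)" if i: "i < g" for i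
    proof -
      have tS: "t \<in> carrier S" using t A by blast
      have md: "m \<le> d" using m g_le_d by simp
      have eq: "\<pi> ((\<sigma> ^^ i) ?t) = (if i < m then c i else \<zero>\<^bsub>K\<^esub>) \<oplus>\<^bsub>K\<^esub> \<pi> ((\<sigma> ^^ (i + (d - m))) w)"
        using tS w t(2)[OF i] by (simp add: sp_sp)
      show ?thesis
      proof (cases "i = m")
        case True
        then have "(\<sigma> ^^ (i + (d - m))) w = w" using md sigma_cyc[OF w(2)] by simp
        then show ?thesis using eq True pw c[OF m] by simp
      next
        case False
        have "\<not> g dvd i + (d - m)"
        proof
          assume "g dvd i + (d - m)"
          then have "[int i + (int d - int m) = 0] (mod int g)"
            using md by (metis cong_0_iff of_nat_add of_nat_diff of_nat_dvd_iff)
          moreover have "[int d = 0] (mod int g)" using g_dvd_d by (simp add: cong_0_iff)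
          ultimately have "[int i + (int d - int m) - int d = 0 - 0] (mod int g)" by (rule cong_diff)
          then have "[int i = int m] (mod int g)" by (simp add: cong_iff_dvd_diff)
          then have "i = m" using i m by (simp add: cong_int_iff cong_def)
          with False show False by simp
        qed
        then show ?thesis using eq pw0 False c[OF i] by (auto simp: less_Suc_eq)
      qed
    qed
    moreover have "?t \<in> A" using t w spA A by blast
    ultimately show ?case by blast
  qed
  from this[of g] show ?thesis by auto
qed

lemma interpolation:
  assumes "\<And>i. i < g \<Longrightarrow> c i \<in> carrier K"
  shows "\<exists>t\<in>carrier S. \<forall>i<g. \<pi> ((\<sigma> ^^ i) t) = c i"
  by (rule interpolation_in_ideal[of _ \<one>]) (use assms in auto)

text \<open>
  This replaces freeness of \<open>S\<close>: an annihilator not inside the radical would contain an element that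
  is invertible on the component at \<open>p\<close>, so that \<open>p ^ i\<close> would vanish there.
\<close>

lemma annihilator_in_radical:
  assumes "i < v" and t: "t \<in> carrier S" and 0: "\<iota> (int (p ^ i) * e) \<otimes> t = \<zero>"
  shows "\<pi> ((\<sigma> ^^ j) t) = \<zero>\<^bsub>K\<^esub>"
proof (rule ccontr)
  assume nz: "\<pi> ((\<sigma> ^^ j) t) \<noteq> \<zero>\<^bsub>K\<^esub>"
  let ?k = "int (p ^ i) * e"
  let ?A = "{x \<in> carrier S. \<iota> ?k \<otimes> x = \<zero>}"
  have \<sigma>A: "\<sigma> x \<in> ?A" if x: "x \<in> ?A" for x
  proof -
    have "\<sigma> (\<iota> ?k \<otimes> x) = \<sigma> \<zero>" using x by simp
    moreover have "\<sigma> (\<iota> ?k \<otimes> x) = \<sigma> (\<iota> ?k) \<otimes> \<sigma> x" using x by (intro sp.hom_mult) auto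
    ultimately show ?thesis using x by (simp add: sigma_iota)
  qed
  have tA: "(\<sigma> ^^ j) t \<in> ?A"
  proof -
    have "t \<in> ?A" using t 0 by simp
    then show ?thesis using \<sigma>A by (induction j) auto
  qed
  have "\<exists>w\<in>?A. \<forall>i<g. \<pi> ((\<sigma> ^^ i) w) = (\<lambda>_. \<one>\<^bsub>K\<^esub>) i"
    by (rule interpolation_in_ideal[OF _ _ _ _ _ tA nz]) (use \<sigma>A in \<open>auto simp: r_distr m_lcomm\<close>)
  then obtain w where w: "w \<in> carrier S" "\<iota> ?k \<otimes> w = \<zero>" "\<And>i. i < g \<Longrightarrow> \<pi> ((\<sigma> ^^ i) w) = \<one>\<^bsub>K\<^esub>"
    by auto
  have "\<pi> ((\<sigma> ^^ i) w) \<noteq> \<zero>\<^bsub>K\<^esub>" for i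
    using pi_sp_eq_zero_mod_g[OF w(1), of i] w(3)[of "i mod g"] g_pos by simp
  then have U: "loc w \<in> Units S" using w(1) by (intro loc_unit)
  have "\<iota> ?k \<otimes> loc w = \<iota> ?k \<otimes> (\<one> \<ominus> E) \<oplus> E \<otimes> (\<iota> ?k \<otimes> w)"
    using w(1) by (simp add: loc_def r_distr m_lcomm)
  also have "\<iota> ?k \<otimes> (\<one> \<ominus> E) = \<iota> (int (p ^ i)) \<otimes> ((\<one> \<ominus> E) \<otimes> E)"
    unfolding iota_mult by (simp only: m_ac iota_closed minus_closed one_closed)
  also have "\<dots> \<oplus> E \<otimes> (\<iota> ?k \<otimes> w) = \<zero>" using w(2) by simp
  finally have "(\<iota> ?k \<otimes> loc w) \<otimes> inv (loc w) = \<zero>" using U by simp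
  then have "\<iota> ?k = \<zero>" using U Units_closed[OF U] by (simp add: m_assoc Units_r_inv del: of_nat_power)
  then have "int (p ^ v) dvd int (p ^ i) * e" using iota_eq_zero n_dvd_iff by blast
  moreover have "coprime (int (p ^ v)) e"
    using e_pv by (metis cong_imp_coprime cong_sym coprime_1_left coprime_commute)
  ultimately have "int (p ^ v) dvd int (p ^ i)" by (simp only: coprime_dvd_mult_left_iff)
  then have "p ^ v dvd p ^ i" by (simp only: of_nat_dvd_iff)
  then show False
    using \<open>i < v\<close> prime_gt_1_nat[OF prime_p] power_dvd_imp_le[of p v i] by simp
qed

end

text \<open>Each fibre of the multiplication map on \<open>V \<times> H\<close> embeds into the
  intersection: two factorisations of the same element satisfy
  \<open>x / x0 = y0 / y\<close>.\<close>

lemma (in comm_group) card_subgroups_mult_le: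
  assumes V: "subgroup V G" and H: "subgroup H G" and fin: "finite (carrier G)"
  shows "card V * card H \<le> order G * card (V \<inter> H)"
proof -
  have VG: "V \<subseteq> carrier G" and HG: "H \<subseteq> carrier G"
    using V H by (auto dest: subgroup.subset)
  have fV: "finite V" and fH: "finite H" using VG HG fin finite_subset by auto
  let ?F = "\<lambda>u. {(x, y). x \<in> V \<and> y \<in> H \<and> x \<otimes> y = u}"
  have fF: "finite (?F u)" for u
    by (rule finite_subset[of _ "V \<times> H"]) (use fV fH in auto)
  have "card (?F u) \<le> card (V \<inter> H)" for u
  proof (cases "?F u = {}")
    case False
    then obtain x0 y0 where 0: "x0 \<in> V" "y0 \<in> H" "x0 \<otimes> y0 = u" by auto
    have c0: "x0 \<in> carrier G" "y0 \<in> carrier G" using 0 VG HG by auto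
    have "inj_on (\<lambda>(x, y). x \<otimes> inv x0) (?F u)"
    proof (rule inj_onI, clarsimp)
      fix x y x' y'
      assume a: "x \<in> V" "y \<in> H" "x' \<in> V" "y' \<in> H" "x' \<otimes> y' = x \<otimes> y"
        "x \<otimes> inv x0 = x' \<otimes> inv x0"
      have c: "x \<in> carrier G" "x' \<in> carrier G" "y \<in> carrier G" "y' \<in> carrier G" using a VG HG by auto
      have "x = x'" using a(6) c c0 by (metis inv_closed r_cancel)
      moreover have "y = y'" using a(5) c \<open>x = x'\<close> by (metis l_cancel)
      ultimately show "x = x' \<and> y = y'" by simp
    qed
    moreover have "(\<lambda>(x, y). x \<otimes> inv x0) ` ?F u \<subseteq> V \<inter> H"
    proof (rule image_subsetI, clarify)
      fix x y assume a: "x \<in> V" "y \<in> H" "u = x \<otimes> y"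
      have c: "x \<in> carrier G" "y \<in> carrier G" using a VG HG by auto
      have "x \<otimes> inv x0 = y0 \<otimes> inv y"
      proof -
        have ic: "inv x0 \<in> carrier G" "inv y \<in> carrier G" using c c0 by auto
        have "x \<otimes> inv x0 = (x \<otimes> inv x0) \<otimes> (y \<otimes> inv y)" using c c0 by simp
        also have "\<dots> = (x \<otimes> y) \<otimes> (inv x0 \<otimes> inv y)" using c c0 ic by (simp only: m_ac m_closed)
        also have "x \<otimes> y = x0 \<otimes> y0" using a 0 by simp
        also have "(x0 \<otimes> y0) \<otimes> (inv x0 \<otimes> inv y) = (x0 \<otimes> inv x0) \<otimes> (y0 \<otimes> inv y)"
          using c c0 ic by (simp only: m_ac m_closed)
        also have "\<dots> = y0 \<otimes> inv y" using c c0 by simp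
        finally show ?thesis .
      qed
      then show "x \<otimes> inv x0 \<in> V \<inter> H"
        using a 0 V H by (metis IntI subgroup.m_closed subgroup.m_inv_closed)
    qed
    ultimately show ?thesis using fV by (meson card_inj_on_le finite_Int)
  qed (simp only: card.empty)
  then have "(\<Sum>u\<in>carrier G. card (?F u)) \<le> (\<Sum>u\<in>carrier G. card (V \<inter> H))"
    by (intro sum_mono)
  moreover have "(\<Sum>u\<in>carrier G. card (?F u)) = card (\<Union>u\<in>carrier G. ?F u)"
    by (rule card_UN_disjoint[symmetric]) (use fin fF in auto)
  moreover have "(\<Union>u\<in>carrier G. ?F u) = V \<times> H" using VG HG by (auto simp: subset_iff)
  ultimately show ?thesis by (simp add: card_cartesian_product order_def)
qed

section \<open>Lower bound for the unit group of the component at \<open>p\<close>\<close>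

context local_cyclic_ring
begin

text \<open>\<open>V\<close> is the unit group of the component at \<open>p\<close>, extended by \<open>1\<close>.\<close>

definition V :: "'a set" where "V = {u \<in> Units S. (\<one> \<ominus> E) \<otimes> u = \<one> \<ominus> E}"

definition bad :: "'a set" where "bad = {x \<in> Units S. \<sigma> x = x [^] n}"

text \<open>The \<open>p\<close>-adic filtration of the component at \<open>p\<close>. It is climbed
  from \<open>D v\<close> to \<open>D 1\<close>, and \<open>D 1\<close> provides the units with
  prescribed residues.\<close>

definition D :: "nat \<Rightarrow> 'a set" where "D i = (\<lambda>s. \<iota> (int (p ^ i) * e) \<otimes> s) ` carrier S"

lemma loc_in_V:
  assumes x: "x \<in> carrier S" and nz: "\<And>i. i < g \<Longrightarrow> \<pi> ((\<sigma> ^^ i) x) \<noteq> \<zero>\<^bsub>K\<^esub>"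
  shows "loc x \<in> V"
proof -
  have "\<pi> ((\<sigma> ^^ i) x) \<noteq> \<zero>\<^bsub>K\<^esub>" for i
    using pi_sp_eq_zero_mod_g[OF x, of i] nz[of "i mod g"] g_pos by simp
  then show ?thesis using loc_unit[OF x] orth_loc[OF x, of 0] by (simp add: V_def)
qed

text \<open>Perturbation by \<open>D 1\<close> stays within the localised elements and amounts to
  adding a multiple of \<open>p\<close>, which leaves all residues unchanged.\<close>

lemma loc_add_D: "x \<in> carrier S \<Longrightarrow> s \<in> carrier S \<Longrightarrow>
   loc x \<oplus> \<iota> (int (p ^ 1) * e) \<otimes> s = loc (x \<oplus> \<iota> (int p) \<otimes> s)"
proof -
  assume x: "x \<in> carrier S" and s: "s \<in> carrier S"
  define P where "P = \<iota> (int p)"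
  have P: "P \<in> carrier S" "E \<in> carrier S" by (simp_all add: P_def)
  have "loc x \<oplus> \<iota> (int (p ^ 1) * e) \<otimes> s = (\<one> \<ominus> E) \<oplus> E \<otimes> x \<oplus> (P \<otimes> E) \<otimes> s"
    by (simp add: loc_def iota_mult P_def)
  also have "\<dots> = (\<one> \<ominus> E) \<oplus> E \<otimes> (x \<oplus> P \<otimes> s)" using P x s by algebra
  finally show ?thesis by (simp add: loc_def P_def)
qed

lemma pi_sp_add_p:
  "x \<in> carrier S \<Longrightarrow> s \<in> carrier S \<Longrightarrow> \<pi> ((\<sigma> ^^ i) (x \<oplus> \<iota> (int p) \<otimes> s)) = \<pi> ((\<sigma> ^^ i) x)"
  by (simp add: pi_p)

text \<open>Only the units are known to be finite in number, but every nonzero residue is the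
  residue of a unit: interpolate it at all conjugates and localise.\<close>

lemma finite_K:
  assumes "finite (Units S)"
  shows "finite (carrier K)"
proof -
  have "carrier K - {\<zero>\<^bsub>K\<^esub>} \<subseteq> \<pi> ` Units S"
  proof
    fix k assume k: "k \<in> carrier K - {\<zero>\<^bsub>K\<^esub>}"
    then obtain t where t: "t \<in> carrier S" "\<And>i. i < g \<Longrightarrow> \<pi> ((\<sigma> ^^ i) t) = k"
      using interpolation[of "\<lambda>_. k"] by auto
    have "loc t \<in> V" using t k by (intro loc_in_V) auto
    moreover have "\<pi> (loc t) = k" using t(1) t(2)[of 0] g_pos by simp
    ultimately show "k \<in> \<pi> ` Units S" unfolding V_def by (metis (mono_tags, lifting) imageI mem_Collect_eq)
  qed
  then have "finite (carrier K - {\<zero>\<^bsub>K\<^esub>})" using assms finite_surj by blast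
  then show ?thesis by simp
qed

lemma D_zero: "\<zero> \<in> D i"
  unfolding D_def by (rule image_eqI[of _ _ \<zero>]) auto

lemma D_antimono: "i \<le> j \<Longrightarrow> D j \<subseteq> D i"
proof
  fix x assume ij: "i \<le> j" and "x \<in> D j"
  then obtain s where s: "s \<in> carrier S" "x = \<iota> (int (p ^ j) * e) \<otimes> s" by (auto simp: D_def)
  have "p ^ j = p ^ i * p ^ (j - i)" using ij by (simp flip: power_add)
  then have "int (p ^ j) * e = (int (p ^ i) * e) * int (p ^ (j - i))" by simp
  then have "x = \<iota> (int (p ^ i) * e) \<otimes> (\<iota> (int (p ^ (j - i))) \<otimes> s)"
    using s by (simp only: iota_mult[of "int (p ^ i) * e"] m_assoc iota_closed)
  then show "x \<in> D i" unfolding D_def using s by blast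
qed

text \<open>Translation by 1 embeds \<open>D 1\<close> into the units. Index 0 is excluded, as
  \<open>D 0\<close> is the entire component and also contains elements that 1 does not shift to
  units.\<close>

lemma finite_D:
  assumes "finite (Units S)" "i > 0"
  shows "finite (D i)"
proof -
  have "inj_on (\<lambda>x. \<one> \<oplus> x) (D 1)"
    by (rule inj_onI) (auto simp: D_def)
  moreover have "(\<lambda>x. \<one> \<oplus> x) ` D 1 \<subseteq> Units S"
  proof (rule image_subsetI)
    fix x assume "x \<in> D 1"
    then obtain s where s: "s \<in> carrier S" "x = \<iota> (int (p ^ 1) * e) \<otimes> s" by (auto simp: D_def)
    have "loc \<one> = \<one>" using iota_closed[of e] unfolding loc_def by algebra
    then have "\<one> \<oplus> x = loc (\<one> \<oplus> \<iota> (int p) \<otimes> s)" using loc_add_D[of \<one> s] s by simp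
    also have "\<dots> \<in> V" using s by (intro loc_in_V) (simp_all add: pi_p)
    finally show "\<one> \<oplus> x \<in> Units S" by (simp add: V_def)
  qed
  ultimately have "finite (D 1)" using assms(1) by (metis finite_subset finite_imageD)
  then show ?thesis using D_antimono[of 1 i] assms(2) finite_subset by auto
qed

lemma interpolate_PiE:
  obtains T where "\<And>c. c \<in> {..<g} \<rightarrow>\<^sub>E carrier K \<Longrightarrow> T c \<in> carrier S"
    and "\<And>c i. c \<in> {..<g} \<rightarrow>\<^sub>E carrier K \<Longrightarrow> i < g \<Longrightarrow> \<pi> ((\<sigma> ^^ i) (T c)) = c i"
proof -
  have "\<exists>t. c \<in> {..<g} \<rightarrow>\<^sub>E carrier K \<longrightarrow> t \<in> carrier S \<and> (\<forall>i<g. \<pi> ((\<sigma> ^^ i) t) = c i)" for c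
    using interpolation[of c] by (auto simp: PiE_iff)
  then show thesis using that by metis
qed

text \<open>Lift each vector of nonzero residues to a unit and perturb it by \<open>D 1\<close>. The
  residues return the vector, and cancellation returns the perturbation.\<close>

lemma card_V_ge_D:
  assumes fin: "finite (Units S)"
  shows "(card (carrier K) - 1) ^ g * card (D 1) \<le> card V"
proof -
  obtain T where T: "\<And>c. c \<in> {..<g} \<rightarrow>\<^sub>E carrier K \<Longrightarrow> T c \<in> carrier S"
    "\<And>c i. c \<in> {..<g} \<rightarrow>\<^sub>E carrier K \<Longrightarrow> i < g \<Longrightarrow> \<pi> ((\<sigma> ^^ i) (T c)) = c i"
    using interpolate_PiE by blast
  let ?B = "{..<g} \<rightarrow>\<^sub>E (carrier K - {\<zero>\<^bsub>K\<^esub>})"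
  have B: "c \<in> {..<g} \<rightarrow>\<^sub>E carrier K" if "c \<in> ?B" for c using that by (auto simp: PiE_iff)
  let ?f = "\<lambda>(c, x). loc (T c) \<oplus> x"
  have rep: "\<exists>y\<in>carrier S. loc (T c) \<oplus> x = loc y \<and> (\<forall>i<g. \<pi> ((\<sigma> ^^ i) y) = c i)"
    if c: "c \<in> ?B" and x: "x \<in> D 1" for c x
  proof -
    obtain s where s: "s \<in> carrier S" "x = \<iota> (int (p ^ 1) * e) \<otimes> s" using x by (auto simp: D_def)
    show ?thesis
      using s T[OF B[OF c]] loc_add_D[of "T c" s] pi_sp_add_p[of "T c" s] PiE_mem[OF B[OF c]]
      by (intro bexI[of _ "T c \<oplus> \<iota> (int p) \<otimes> s"]) auto
  qed
  have "inj_on ?f (?B \<times> D 1)"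
  proof (rule inj_onI, clarify)
    fix c x c' x'
    assume a: "c \<in> ?B" "x \<in> D 1" "c' \<in> ?B" "x' \<in> D 1" and eq: "loc (T c) \<oplus> x = loc (T c') \<oplus> x'"
    have "c i = c' i" if "i < g" for i
      using rep[OF a(1,2)] rep[OF a(3,4)] eq that pi_sp_loc[of _ i] by metis
    then have "c = c'" using a(1,3) by (metis PiE_ext lessThan_iff)
    moreover have "x \<in> carrier S" "x' \<in> carrier S" using a by (auto simp: D_def)
    ultimately show "c = c' \<and> x = x'" using eq T(1)[OF B[OF a(1)]] by auto
  qed
  moreover have "?f ` (?B \<times> D 1) \<subseteq> V"
  proof (rule image_subsetI, clarify)
    fix c x assume a: "c \<in> ?B" "x \<in> D 1"
    from rep[OF a] obtain y where y: "y \<in> carrier S" "loc (T c) \<oplus> x = loc y"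
      "\<And>i. i < g \<Longrightarrow> \<pi> ((\<sigma> ^^ i) y) = c i" by blast
    have "loc y \<in> V" using y(1,3) a(1) by (intro loc_in_V) (auto simp: PiE_iff)
    then show "loc (T c) \<oplus> x \<in> V" using y(2) by simp
  qed
  moreover have "finite V" using fin by (simp add: V_def)
  ultimately have "card (?B \<times> D 1) \<le> card V" using card_inj_on_le by blast
  moreover have "card (carrier K - {\<zero>\<^bsub>K\<^esub>}) = card (carrier K) - 1"
    using finite_K[OF fin] by simp
  ultimately show ?thesis by (simp add: card_cartesian_product card_PiE)
qed

text \<open>Multiplication by \<open>p ^ i * e\<close> sends lifts of distinct residue vectors to
  distinct classes modulo \<open>D (Suc i)\<close>: a coincidence would give an annihilated element
  with a nonzero residue, which \<open>i < v\<close> rules out.\<close>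

lemma card_D_ge:
  assumes fin: "finite (Units S)" and i: "0 < i" "i < v"
  shows "card (carrier K) ^ g * card (D (Suc i)) \<le> card (D i)"
proof -
  obtain T where T: "\<And>c. c \<in> {..<g} \<rightarrow>\<^sub>E carrier K \<Longrightarrow> T c \<in> carrier S"
    "\<And>c i. c \<in> {..<g} \<rightarrow>\<^sub>E carrier K \<Longrightarrow> i < g \<Longrightarrow> \<pi> ((\<sigma> ^^ i) (T c)) = c i"
    using interpolate_PiE by blast
  let ?B = "{..<g} \<rightarrow>\<^sub>E carrier K"
  define P where "P = \<iota> (int (p ^ i) * e)"
  have P: "P \<in> carrier S" by (simp add: P_def)
  have P': "\<iota> (int (p ^ Suc i) * e) = P \<otimes> \<iota> (int p)"
    unfolding P_def iota_mult[symmetric] by (simp add: ac_simps)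
  let ?f = "\<lambda>(c, x). P \<otimes> T c \<oplus> x"
  have "inj_on ?f (?B \<times> D (Suc i))"
  proof (rule inj_onI, clarify)
    fix c x c' x'
    assume a: "c \<in> ?B" "x \<in> D (Suc i)" "c' \<in> ?B" "x' \<in> D (Suc i)"
      and eq: "P \<otimes> T c \<oplus> x = P \<otimes> T c' \<oplus> x'"
    obtain s s' where s: "s \<in> carrier S" "s' \<in> carrier S"
      and xs: "x = (P \<otimes> \<iota> (int p)) \<otimes> s" "x' = (P \<otimes> \<iota> (int p)) \<otimes> s'"
      using a(2,4) by (auto simp only: D_def P')
    define Q where "Q = \<iota> (int p)"
    have Q: "Q \<in> carrier S" by (simp add: Q_def)
    define t t' where "t = T c" and "t' = T c'"
    have t: "t \<in> carrier S" "t' \<in> carrier S" using T(1) a by (auto simp: t_def t'_def)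
    define y where "y = (t \<oplus> Q \<otimes> s) \<ominus> (t' \<oplus> Q \<otimes> s')"
    have y: "y \<in> carrier S" using t Q s by (simp add: y_def)
    have "P \<otimes> y = (P \<otimes> t \<oplus> (P \<otimes> Q) \<otimes> s) \<ominus> (P \<otimes> t' \<oplus> (P \<otimes> Q) \<otimes> s')"
      unfolding y_def using P Q s t by algebra
    also have "\<dots> = \<zero>" using eq xs P Q s t by (simp add: Q_def t_def t'_def minus_eq r_neg)
    finally have "\<pi> ((\<sigma> ^^ j) y) = \<zero>\<^bsub>K\<^esub>" for j
      using annihilator_in_radical[OF i(2) y] by (simp add: P_def)
    then have "\<pi> ((\<sigma> ^^ j) t) = \<pi> ((\<sigma> ^^ j) t')" for j
      using t Q s by (simp add: y_def pi_minus Q_def pi_p)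
    then have "c j = c' j" if "j < g" for j
      using T(2)[OF a(1) that] T(2)[OF a(3) that] by (simp add: t_def t'_def)
    then have "c = c'" using a(1,3) by (metis PiE_ext lessThan_iff)
    moreover have "x \<in> carrier S" "x' \<in> carrier S" using a by (auto simp: D_def)
    ultimately show "c = c' \<and> x = x'" using eq P T(1)[OF a(1)] by auto
  qed
  moreover have "?f ` (?B \<times> D (Suc i)) \<subseteq> D i"
  proof (rule image_subsetI, clarify)
    fix c x assume a: "c \<in> ?B" "x \<in> D (Suc i)"
    then obtain s where s: "s \<in> carrier S" "x = (P \<otimes> \<iota> (int p)) \<otimes> s" by (auto simp only: D_def P')
    have "P \<otimes> T c \<oplus> x = P \<otimes> (T c \<oplus> \<iota> (int p) \<otimes> s)"
      using s P T(1)[OF a(1)] by (simp add: r_distr m_assoc)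
    then show "P \<otimes> T c \<oplus> x \<in> D i" unfolding D_def P_def[symmetric] using s T(1)[OF a(1)] by blast
  qed
  ultimately have "card (?B \<times> D (Suc i)) \<le> card (D i)"
    using finite_D[OF fin i(1)] card_inj_on_le by blast
  then show ?thesis by (simp add: card_cartesian_product card_PiE)
qed

lemma card_V_ge:
  assumes fin: "finite (Units S)"
  shows "(card (carrier K) - 1) ^ g * (card (carrier K) ^ g) ^ (v - 1) \<le> card V"
proof -
  let ?q = "card (carrier K)"
  have "(?q ^ g) ^ j * card (D (Suc j)) \<le> card (D 1)" if "j < v" for j
    using that
  proof (induction j)
    case (Suc j)
    have "(?q ^ g) ^ Suc j * card (D (Suc (Suc j))) = (?q ^ g) ^ j * (?q ^ g * card (D (Suc (Suc j))))"
      by simp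
    also have "\<dots> \<le> (?q ^ g) ^ j * card (D (Suc j))"
      using Suc.prems by (intro mult_left_mono card_D_ge[OF fin]) auto
    also have "\<dots> \<le> card (D 1)" using Suc by simp
    finally show ?case .
  qed simp
  from this[of "v - 1"] have "(?q ^ g) ^ (v - 1) * card (D v) \<le> card (D 1)" using v_pos by simp
  \<comment> \<open>Presence of 0 is enough at the end of the chain.\<close>
  moreover have "card (D v) \<ge> 1"
    using finite_D[OF fin v_pos] D_zero by (metis One_nat_def Suc_leI card_gt_0_iff empty_iff)
  ultimately have "(?q ^ g) ^ (v - 1) \<le> card (D 1)"
    by (metis le_trans mult.right_neutral mult_le_mono2)
  then have "(?q - 1) ^ g * (?q ^ g) ^ (v - 1) \<le> (?q - 1) ^ g * card (D 1)" by (rule mult_le_mono2)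
  also have "\<dots> \<le> card V" using card_V_ge_D[OF fin] .
  finally show ?thesis .
qed

end

section \<open>Bad elements of the component and the residue degree\<close>

context local_cyclic_ring
begin

lemma sp_bad:
  assumes "x \<in> bad"
  shows "(\<sigma> ^^ i) x = x [^] (n ^ i)"
proof (induction i)
  case 0
  show ?case using assms by (simp add: bad_def Units_closed)
next
  case (Suc i)
  have x: "x \<in> carrier S" "\<sigma> x = x [^] n" using assms by (auto simp: bad_def)
  have "(\<sigma> ^^ Suc i) x = \<sigma> (x [^] (n ^ i))" using Suc by simp
  also have "\<dots> = \<sigma> x [^] (n ^ i)" using sp_pow[OF x(1), of 1] by simp
  finally show ?case using x by (simp add: nat_pow_pow)
qed

text \<open>
  For bad \<open>x\<close>, \<open>y\<close> with the same residue, \<open>c = x - y\<close> satisfies \<open>\<sigma> c = c j\<close> with \<open>j\<close> in the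
  radical because \<open>n = 0\<close> in \<open>S\<close>; iterating \<open>d\<close> times gives \<open>c = c j'\<close>, hence \<open>c = 0\<close>.
\<close>

lemma inj_on_pi_bad: "inj_on \<pi> (V \<inter> bad)"
proof (rule inj_onI)
  fix x y assume x: "x \<in> V \<inter> bad" and y: "y \<in> V \<inter> bad" and eq: "\<pi> x = \<pi> y"
  have xS: "x \<in> carrier S" and yS: "y \<in> carrier S" using x y by (auto simp: V_def)
  define c where "c = x \<ominus> y"
  have c: "c \<in> carrier S" and xc: "x = y \<oplus> c" using xS yS by (simp_all add: c_def, algebra)
  \<comment> \<open>For a bad element \<open>\<sigma>\<close> acts as a power map, so one residue
    determines the residues of all conjugates.\<close>
  have pc: "\<pi> ((\<sigma> ^^ i) c) = \<zero>\<^bsub>K\<^esub>" for i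
    using xS yS sp_bad[of x i] sp_bad[of y i] x y eq
    by (simp add: c_def pi_minus pi_pow K.minus_eq K.r_neg)
  obtain z where z: "z \<in> carrier S"
    "(y \<oplus> c) [^] n = y [^] n \<oplus> c \<otimes> (\<iota> (int n) \<otimes> y [^] (n - 1) \<oplus> c \<otimes> z)"
    using pow_add_expand[OF c yS] by blast
  have n0: "\<iota> (int n) = \<zero>" using iota_eq_zero by simp
  have sc: "\<sigma> c = c \<otimes> (c \<otimes> z)"
  proof -
    have "\<sigma> x = y [^] n \<oplus> c \<otimes> (c \<otimes> z)"
      using z n0 c yS x xc by (simp add: bad_def)
    moreover have "\<sigma> y = y [^] n" using y by (simp add: bad_def)
    moreover have "\<sigma> x = \<sigma> y \<oplus> \<sigma> c" using xc yS c by simp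
    ultimately have "y [^] n \<oplus> \<sigma> c = y [^] n \<oplus> c \<otimes> (c \<otimes> z)" by simp
    then show ?thesis using c z(1) yS by (metis add.l_cancel m_closed nat_pow_closed sp.hom_closed)
  qed
  have "\<exists>j\<in>carrier S. (\<sigma> ^^ Suc k) c = c \<otimes> j \<and> (\<forall>i. \<pi> ((\<sigma> ^^ i) j) = \<zero>\<^bsub>K\<^esub>)" for k
  proof (induction k)
    case 0
    show ?case using sc c z(1) pc by (intro bexI[of _ "c \<otimes> z"]) auto
  next
    case (Suc k)
    then obtain j where j: "j \<in> carrier S" "(\<sigma> ^^ Suc k) c = c \<otimes> j" "\<And>i. \<pi> ((\<sigma> ^^ i) j) = \<zero>\<^bsub>K\<^esub>"
      by blast
    have "(\<sigma> ^^ Suc (Suc k)) c = \<sigma> (c \<otimes> j)" using j(2) by simp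
    also have "\<dots> = c \<otimes> ((c \<otimes> z) \<otimes> \<sigma> j)" using c j(1) z(1) by (simp add: sc m_assoc)
    finally show ?case using c z(1) pc j(1)
      by (intro bexI[of _ "(c \<otimes> z) \<otimes> \<sigma> j"]) auto
  qed
  \<comment> \<open>The full cycle returns to \<open>c\<close> itself.\<close>
  from this[of "d - 1"] obtain j where j: "j \<in> carrier S" "c = c \<otimes> j" "\<And>i. \<pi> ((\<sigma> ^^ i) j) = \<zero>\<^bsub>K\<^esub>"
    using d_pos sigma_cyc[OF c] by auto
  define F where "F = \<one> \<ominus> E"
  have F: "F \<in> carrier S" by (simp add: F_def)
  have "F \<otimes> c = F \<otimes> x \<ominus> F \<otimes> y" using xS yS F unfolding c_def by algebra
  also have "\<dots> = \<zero>"
  proof -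
    have "F \<otimes> x = F" "F \<otimes> y = F" using x y by (auto simp: V_def F_def)
    then show ?thesis using F by (simp add: minus_eq r_neg)
  qed
  finally have Fc: "c \<otimes> F = \<zero>" using F c by (simp add: m_comm)
  \<comment> \<open>On the component \<open>1 - j\<close> is a unit since \<open>j\<close> has zero
    residues, and it kills \<open>c\<close>; off the component \<open>c\<close> vanishes because
    \<open>x\<close> and \<open>y\<close> are both 1 there.\<close>
  have U: "loc (\<one> \<ominus> j) \<in> Units S"
    using j by (intro loc_unit) (auto simp: pi_minus)
  have "c \<otimes> loc (\<one> \<ominus> j) = c \<otimes> F \<oplus> E \<otimes> (c \<ominus> c \<otimes> j)"
    unfolding loc_def F_def[symmetric] using c j(1) F iota_closed[of e] by algebra
  also have "\<dots> = \<zero>" using Fc j(2) c by (simp add: minus_eq r_neg)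
  finally have "(c \<otimes> loc (\<one> \<ominus> j)) \<otimes> inv (loc (\<one> \<ominus> j)) = \<zero>" using U by simp
  then have "c = \<zero>" using U c Units_closed[OF U] by (simp add: m_assoc Units_r_inv)
  then show "x = y" using xc yS by simp
qed

lemma finite_prime_field_K:
  assumes "finite (Units S)"
  shows "finite_prime_field K (\<lambda>k. \<pi> (\<iota> k)) p"
  by unfold_locales (use finite_K[OF assms] prime_p pi_p in \<open>auto simp: iota_add iota_mult\<close>)

text \<open>Makes the Frobenius exponent uniform. It is read off at a lift \<open>z\<close> of a
  generator; any \<open>s\<close> with nonzero residue differs from a power of \<open>z\<close> by
  an element of the kernel, which \<open>\<sigma> ^^ i\<close> preserves.\<close>

lemma pi_sp_pow:
  assumes fin: "finite (Units S)" and f: "card (carrier K) = p ^ f" "f > 0"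
    and z: "z \<in> carrier S" and gen: "\<And>x. x \<in> carrier K \<Longrightarrow> x \<noteq> \<zero>\<^bsub>K\<^esub> \<Longrightarrow> \<exists>i::nat. x = \<pi> z [^]\<^bsub>K\<^esub> i"
    and i: "g dvd i"
  shows "\<exists>a<f. \<forall>s\<in>carrier S. \<pi> ((\<sigma> ^^ i) s) = \<pi> s [^]\<^bsub>K\<^esub> (p ^ a)"
proof -
  interpret F: finite_prime_field K "\<lambda>k. \<pi> (\<iota> k)" p by (rule finite_prime_field_K[OF fin])
  have hom: "(\<lambda>s. \<pi> ((\<sigma> ^^ i) s)) \<in> ring_hom S K"
    by (auto simp: ring_hom_def)
  have ker: "\<pi> ((\<sigma> ^^ i) s) = \<zero>\<^bsub>K\<^esub> \<longleftrightarrow> \<pi> s = \<zero>\<^bsub>K\<^esub>" if "s \<in> carrier S" for s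
    using stab_iff[of i] i that unfolding stab_def by blast
  have "\<exists>a<f. (\<lambda>s. \<pi> ((\<sigma> ^^ i) s)) z = \<pi> z [^]\<^bsub>K\<^esub> (p ^ a)"
    by (rule F.hom_eq_frobenius_power[OF int_cring_axioms f pi_hom _ hom]) (use ker z in auto)
  then obtain a where a: "a < f" "\<pi> ((\<sigma> ^^ i) z) = \<pi> z [^]\<^bsub>K\<^esub> (p ^ a)" by blast
  have "\<pi> ((\<sigma> ^^ i) s) = \<pi> s [^]\<^bsub>K\<^esub> (p ^ a)" if s: "s \<in> carrier S" for s
  proof (cases "\<pi> s = \<zero>\<^bsub>K\<^esub>")
    case True
    moreover have "p ^ a \<noteq> 0" using prime_gt_0_nat[OF prime_p] by simp
    ultimately show ?thesis using ker[OF s] by (simp add: K.nat_pow_zero)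
  next
    case False
    then obtain m :: nat where m: "\<pi> s = \<pi> z [^]\<^bsub>K\<^esub> m" using gen[of "\<pi> s"] s by auto
    have "\<pi> (s \<ominus> z [^] m) = \<zero>\<^bsub>K\<^esub>" using s z m by (simp add: pi_minus pi_pow K.minus_eq K.r_neg)
    then have "\<pi> ((\<sigma> ^^ i) (s \<ominus> z [^] m)) = \<zero>\<^bsub>K\<^esub>" using ker[of "s \<ominus> z [^] m"] s z by simp
    then have "\<pi> ((\<sigma> ^^ i) s) = \<pi> ((\<sigma> ^^ i) z) [^]\<^bsub>K\<^esub> m"
      using s z by (simp add: pi_minus sp_pow pi_pow)
    also have "\<dots> = \<pi> s [^]\<^bsub>K\<^esub> (p ^ a)"
      unfolding a m using z by (simp add: K.nat_pow_pow mult.commute)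
    finally show ?thesis .
  qed
  with a show ?thesis by blast
qed

text \<open>The powers of \<open>\<sigma> ^^ g\<close> below \<open>h = d / g\<close> induce
  distinct Frobenius powers, of which a field of order \<open>p ^ f\<close> has only
  \<open>f\<close>. So \<open>h \<le> f\<close>, and raising to the power \<open>g\<close> gives the
  claim.\<close>

lemma card_K_ge:
  assumes fin: "finite (Units S)"
  shows "p ^ d \<le> card (carrier K) ^ g"
proof -
  interpret F: finite_prime_field K "\<lambda>k. \<pi> (\<iota> k)" p by (rule finite_prime_field_K[OF fin])
  obtain f where f: "card (carrier K) = p ^ f" "f > 0" using F.card_carrier_prime_power by blast
  obtain z' where z': "z' \<in> carrier K"
    "\<And>x. x \<in> carrier K \<Longrightarrow> x \<noteq> \<zero>\<^bsub>K\<^esub> \<Longrightarrow> \<exists>i::nat. x = z' [^]\<^bsub>K\<^esub> i"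
    using F.exists_generator by blast
  then obtain z where z: "z \<in> carrier S" "z' = \<pi> z" using pi_surj by auto
  define h where "h = d div g"
  have gh: "g * h = d" using g_dvd_d by (simp add: h_def)
  have "\<exists>a. \<forall>i. a i < f \<and> (\<forall>s\<in>carrier S. \<pi> ((\<sigma> ^^ (g * i)) s) = \<pi> s [^]\<^bsub>K\<^esub> (p ^ a i))"
    using pi_sp_pow[OF fin f z(1) z'(2)[unfolded z(2)], of "g * _"] by (intro choice allI) auto
  then obtain a where a: "\<And>i. a i < f"
    "\<And>i s. s \<in> carrier S \<Longrightarrow> \<pi> ((\<sigma> ^^ (g * i)) s) = \<pi> s [^]\<^bsub>K\<^esub> (p ^ a i)" by blast
  have ne: "a i \<noteq> a j" if ij: "i < j" "j < h" for i j
  proof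
    assume aij: "a i = a j"
    have gi: "g * i \<le> d" using ij gh by (metis less_imp_le less_trans mult_le_mono2)
    have "g * (j - i) > 0" using g_pos ij by simp
    moreover have "g * (j - i) < d" using g_pos ij gh by (metis less_imp_diff_less nat_mult_less_cancel1)
    ultimately obtain s where s: "s \<in> carrier S" "\<pi> ((\<sigma> ^^ (g * (j - i))) s) \<noteq> \<pi> s"
      using pi_galois by blast
    \<comment> \<open>\<open>d - g * i\<close> serves as \<open>-(g * i)\<close>, which reduces
      equal actions of two powers to a trivial action of their quotient.\<close>
    let ?s = "(\<sigma> ^^ (d - g * i)) s"
    have "\<pi> ((\<sigma> ^^ (g * i)) ?s) = \<pi> ((\<sigma> ^^ (g * j)) ?s)" using a(2)[of ?s] s(1) aij by simp
    moreover have "(\<sigma> ^^ (g * i)) ?s = s" using gi s(1) by (simp add: sp_sp sigma_cyc)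
    moreover have "(\<sigma> ^^ (g * j)) ?s = (\<sigma> ^^ (g * (j - i))) s"
    proof -
      have "g * j + (d - g * i) = g * (j - i) + d" using gi ij by (simp add: diff_mult_distrib2)
      then show ?thesis using sp_add_d[OF s(1)] by (simp only: sp_sp)
    qed
    ultimately show False using s(2) by simp
  qed
  have "inj_on a {..<h}"
    by (rule inj_onI) (metis ne lessThan_iff linorder_neqE_nat)
  moreover have "a ` {..<h} \<subseteq> {..<f}" using a(1) by auto
  ultimately have "card {..<h} \<le> card {..<f}" by (intro card_inj_on_le) auto
  then have hf: "h \<le> f" by simp
  have "p ^ d = (p ^ h) ^ g" using gh by (metis mult.commute power_mult)
  also have "\<dots> \<le> (p ^ f) ^ g"
    using hf prime_gt_0_nat[OF prime_p] by (intro power_mono power_increasing) auto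
  finally show ?thesis using f by simp
qed

text \<open>Squaring gives both cases one form: for \<open>g \<ge> 2\<close> injectivity alone
  bounds the count by \<open>q\<close>, and the square of \<open>q\<close> is at most
  \<open>q ^ g\<close>; for \<open>g = 1\<close> a square root of \<open>q\<close> must be
  saved.\<close>

lemma card_V_bad_le:
  assumes fin: "finite (Units S)" and npp: "\<not> primepow n"
  shows "(card (V \<inter> bad))\<^sup>2 \<le> n\<^sup>2 * card (carrier K) ^ g"
proof -
  interpret F: finite_prime_field K "\<lambda>k. \<pi> (\<iota> k)" p by (rule finite_prime_field_K[OF fin])
  have VS: "V \<inter> bad \<subseteq> carrier S" by (auto simp: V_def)
  let ?q = "card (carrier K)"
  show ?thesis
  proof (cases "g = 1")
    case False
    then have g2: "g \<ge> 2" using g_pos by simp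
    have "\<pi> ` (V \<inter> bad) \<subseteq> carrier K" using VS by auto
    then have "card (V \<inter> bad) \<le> ?q" using inj_on_pi_bad F.fin card_inj_on_le by blast
    then have "(card (V \<inter> bad))\<^sup>2 \<le> ?q\<^sup>2" by (rule power_mono) simp
    also have "\<dots> \<le> ?q ^ g"
      using g2 F.fin by (intro power_increasing) (auto simp: Suc_le_eq card_gt_0_iff)
    also have "\<dots> \<le> n\<^sup>2 * ?q ^ g" using n_gt_1 by simp
    finally show ?thesis .
  next
    case True
    obtain f where f: "?q = p ^ f" "f > 0" using F.card_carrier_prime_power by blast
    obtain z' where z': "z' \<in> carrier K"
      "\<And>x. x \<in> carrier K \<Longrightarrow> x \<noteq> \<zero>\<^bsub>K\<^esub> \<Longrightarrow> \<exists>i::nat. x = z' [^]\<^bsub>K\<^esub> i"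
      using F.exists_generator by blast
    then obtain z where z: "z \<in> carrier S" "z' = \<pi> z" using pi_surj by auto
    obtain a where a: "a < f" "\<And>s. s \<in> carrier S \<Longrightarrow> \<pi> (\<sigma> s) = \<pi> s [^]\<^bsub>K\<^esub> (p ^ a)"
      using pi_sp_pow[OF fin f z(1) z'(2)[unfolded z(2)], of 1] True by auto
    \<comment> \<open>For \<open>a = 0\<close> this is \<open>n > 1\<close>; otherwise
      \<open>p ^ a\<close> is a prime power.\<close>
    have na: "n \<noteq> p ^ a"
      using npp n_gt_1 prime_p by (cases "a = 0") (auto simp: primepow_prime_power)
    let ?Z = "{x \<in> carrier K. x \<noteq> \<zero>\<^bsub>K\<^esub> \<and> x [^]\<^bsub>K\<^esub> (p ^ a) = x [^]\<^bsub>K\<^esub> n}"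
    have "\<pi> ` (V \<inter> bad) \<subseteq> ?Z"
    proof (rule image_subsetI)
      fix x assume x: "x \<in> V \<inter> bad"
      then have xS: "x \<in> carrier S" "x \<in> Units S" using VS by (auto simp: V_def)
      have "\<pi> x [^]\<^bsub>K\<^esub> (p ^ a) = \<pi> (x [^] n)" using a(2)[OF xS(1)] x by (simp add: bad_def)
      moreover have "\<pi> x \<otimes>\<^bsub>K\<^esub> \<pi> (inv x) = \<one>\<^bsub>K\<^esub>"
        using xS by (simp flip: pi.hom_mult)
      then have "\<pi> x \<noteq> \<zero>\<^bsub>K\<^esub>" using xS by auto
      ultimately show "\<pi> x \<in> ?Z" using xS by (simp add: pi_pow)
    qed
    then have "card (V \<inter> bad) \<le> card ?Z"
      using inj_on_pi_bad F.fin by (intro card_inj_on_le) auto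
    then have "(card (V \<inter> bad))\<^sup>2 \<le> (card ?Z)\<^sup>2" by (rule power_mono) simp
    also have "\<dots> \<le> n\<^sup>2 * ?q"
      by (rule F.card_frobenius_power_eq_pow[OF f(1) a(1) n_gt_1 na])
    finally show ?thesis using True by simp
  qed
qed

text \<open>The proportion of bad elements among all units is at most their proportion in the
  subgroup \<open>V\<close>, so studying a single prime suffices.\<close>

lemma card_V_mult_bad:
  assumes fin: "finite (Units S)"
  shows "card V * card bad \<le> card (Units S) * card (V \<inter> bad)"
proof -
  interpret G: comm_group "units_of S" by (rule units_comm_group)
  have inv_eq: "inv\<^bsub>units_of S\<^esub> x = inv x" if "x \<in> Units S" for x
    using that by (rule units_of_inv)
  have "subgroup V (units_of S)"
  proof (rule G.subgroupI)
    show "V \<subseteq> carrier (units_of S)" by (auto simp: V_def units_of_carrier)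
    show "V \<noteq> {}" by (auto simp: V_def intro!: exI[of _ \<one>])
  next
    fix x assume x: "x \<in> V"
    then have xU: "x \<in> Units S" "(\<one> \<ominus> E) \<otimes> x = \<one> \<ominus> E" by (auto simp: V_def)
    have "(\<one> \<ominus> E) \<otimes> inv x = ((\<one> \<ominus> E) \<otimes> x) \<otimes> inv x" using xU by simp
    also have "\<dots> = \<one> \<ominus> E" using xU(1) by (simp add: m_assoc Units_closed)
    finally show "inv\<^bsub>units_of S\<^esub> x \<in> V" using xU(1) by (simp add: inv_eq V_def)
  next
    fix x y assume xy: "x \<in> V" "y \<in> V"
    then have "x \<in> Units S" "y \<in> Units S" by (auto simp: V_def)
    moreover have "(\<one> \<ominus> E) \<otimes> (x \<otimes> y) = ((\<one> \<ominus> E) \<otimes> x) \<otimes> y"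
      by (rule m_assoc[symmetric]) (use xy in \<open>auto simp: V_def\<close>)
    ultimately show "x \<otimes>\<^bsub>units_of S\<^esub> y \<in> V"
      using xy by (simp add: V_def units_of_mult)
  qed
  moreover have "subgroup bad (units_of S)"
  proof (rule G.subgroupI)
    show "bad \<subseteq> carrier (units_of S)" by (auto simp: bad_def units_of_carrier)
    show "bad \<noteq> {}" by (auto simp: bad_def intro!: exI[of _ \<one>])
  next
    fix x assume x: "x \<in> bad"
    then have xU: "x \<in> Units S" "\<sigma> x = x [^] n" by (auto simp: bad_def)
    have "x [^] n \<otimes> \<sigma> (inv x) = \<sigma> (x \<otimes> inv x)" using xU by (simp add: Units_closed del: Units_r_inv)
    also have "\<dots> = \<one>" using xU(1) by simp
    finally have 1: "x [^] n \<otimes> \<sigma> (inv x) = \<one>" .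
    have 2: "x [^] n \<otimes> (inv x) [^] n = \<one>"
      using xU(1) by (simp add: Units_closed flip: nat_pow_distrib)
    have "x [^] n \<in> Units S" using xU(1) by (rule Units_pow_closed)
    then have "\<sigma> (inv x) = (inv x) [^] n"
      using 1 2 xU(1) by (metis Units_inv_closed Units_l_cancel nat_pow_closed sp.hom_closed)
    then show "inv\<^bsub>units_of S\<^esub> x \<in> bad" using xU(1) by (simp add: inv_eq bad_def)
  next
    fix x y assume "x \<in> bad" "y \<in> bad"
    then show "x \<otimes>\<^bsub>units_of S\<^esub> y \<in> bad"
      by (simp add: bad_def units_of_mult Units_closed nat_pow_distrib)
  qed
  ultimately have "card V * card bad \<le> order (units_of S) * card (V \<inter> bad)"
    using fin by (intro G.card_subgroups_mult_le) (auto simp: units_of_carrier)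
  then show ?thesis by (simp add: order_def units_of_carrier)
qed

lemma bad_density_sq_le:
  assumes fin: "finite (Units S)" and npp: "\<not> primepow n"
  shows "(real (card bad) / real (card (Units S)))\<^sup>2 * (real (p ^ v) ^ d * (1 - 1 / real p) ^ (2 * d)) \<le> (real n)\<^sup>2"
proof -
  define q where "q = real (card (carrier K))"
  define U where "U = real (card (Units S))"
  define b where "b = real (card bad)"
  define W where "W = real (card (V \<inter> bad))"
  have q0: "card (carrier K) > 0" using finite_K[OF fin] by (auto simp: card_gt_0_iff)
  have p1: "real p > 1" using prime_gt_1_nat[OF prime_p] by simp
  have pq: "real p ^ d \<le> q ^ g"
    using card_K_ge[OF fin] unfolding q_def by (simp flip: of_nat_power)
  have pleq: "real p \<le> q"
  proof -
    interpret F: finite_prime_field K "\<lambda>k. \<pi> (\<iota> k)" p by (rule finite_prime_field_K[OF fin])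
    obtain f where f: "card (carrier K) = p ^ f" "f > 0" using F.card_carrier_prime_power by blast
    then have "p ^ 1 \<le> p ^ f" using prime_gt_0_nat[OF prime_p] by (intro power_increasing) auto
    then show ?thesis using f by (simp add: q_def)
  qed
  have U0: "U > 0" using fin Units_one_closed by (auto simp: U_def card_gt_0_iff)
  have q1: "q > 1" using p1 pleq by simp
  have "real ((card (carrier K) - 1) ^ g * (card (carrier K) ^ g) ^ (v - 1)) \<le> real (card V)"
    using card_V_ge[OF fin] by (simp only: of_nat_le_iff)
  then have V: "(q - 1) ^ g * (q ^ g) ^ (v - 1) \<le> real (card V)"
    using q0 by (simp add: q_def of_nat_diff Suc_le_eq)
  have "real (card V * card bad) \<le> real (card (Units S) * card (V \<inter> bad))"
    using card_V_mult_bad[OF fin] by (simp only: of_nat_le_iff)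
  then have "real (card V) * b \<le> U * W" by (simp add: b_def U_def W_def)
  moreover have "(q - 1) ^ g * (q ^ g) ^ (v - 1) * b \<le> real (card V) * b"
    using V by (intro mult_right_mono) (auto simp: b_def)
  ultimately have "(q - 1) ^ g * (q ^ g) ^ (v - 1) * b \<le> U * W" by simp
  then have "((q - 1) ^ g * (q ^ g) ^ (v - 1) * b)\<^sup>2 \<le> (U * W)\<^sup>2"
    using q1 by (intro power_mono) (auto simp: b_def)
  also have "\<dots> \<le> U\<^sup>2 * ((real n)\<^sup>2 * q ^ g)"
  proof -
    have "real ((card (V \<inter> bad))\<^sup>2) \<le> real (n\<^sup>2 * card (carrier K) ^ g)"
      using card_V_bad_le[OF fin npp] by (simp only: of_nat_le_iff)
    then show ?thesis unfolding power_mult_distrib by (intro mult_left_mono) (simp_all add: W_def q_def)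
  qed
  finally have main: "((q - 1) ^ g * (q ^ g) ^ (v - 1) * b)\<^sup>2 \<le> U\<^sup>2 * ((real n)\<^sup>2 * q ^ g)" .
  define Q where "Q = q ^ g"
  have Q1: "Q \<ge> 1" using q1 by (simp add: Q_def)
  have qg: "(q - 1) ^ g = (1 - 1 / q) ^ g * Q"
  proof -
    have "(1 - 1 / q) * q = q - 1" using q1 by (simp add: field_simps)
    then show ?thesis unfolding Q_def by (metis power_mult_distrib)
  qed
  have "(q - 1) ^ g * Q ^ (v - 1) = (1 - 1 / q) ^ g * Q ^ v"
    unfolding qg using v_pos by (cases v) auto
  then have "((1 - 1 / q) ^ g * Q ^ v * b)\<^sup>2 \<le> U\<^sup>2 * ((real n)\<^sup>2 * Q)"
    using main by (simp add: Q_def)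
  \<comment> \<open>The bound for bad elements costs one factor \<open>Q\<close> after squaring.
    Since \<open>v \<ge> 1\<close>, it can be cancelled while \<open>Q ^ v\<close> remains, whatever
    \<open>v\<close> is.\<close>
  moreover have "Q ^ v * Q \<le> (Q ^ v)\<^sup>2"
    using Q1 v_pos self_le_power[of Q v] by (simp add: power2_eq_square)
  then have "((1 - 1 / q) ^ g * b)\<^sup>2 * (Q ^ v * Q) \<le> ((1 - 1 / q) ^ g * b)\<^sup>2 * (Q ^ v)\<^sup>2"
    by (intro mult_left_mono) auto
  ultimately have "((1 - 1 / q) ^ g * b)\<^sup>2 * Q ^ v * Q \<le> (U\<^sup>2 * (real n)\<^sup>2) * Q"
    by (simp add: power_mult_distrib mult_ac)
  then have "((1 - 1 / q) ^ g * b)\<^sup>2 * Q ^ v \<le> U\<^sup>2 * (real n)\<^sup>2"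
    using Q1 by (simp add: mult_le_cancel_right)
  moreover have "((1 - 1 / p) ^ d * b)\<^sup>2 * (real p ^ d) ^ v \<le> ((1 - 1 / q) ^ g * b)\<^sup>2 * Q ^ v"
  proof (intro mult_mono power_mono)
    \<comment> \<open>\<open>p \<le> q\<close> and \<open>g \<le> d\<close> eliminate the residue
      field and the orbit length, which depend on how \<open>p\<close> splits.\<close>
    have "(1 - 1 / real p) ^ d \<le> (1 - 1 / real p) ^ g"
      using p1 g_le_d by (intro power_decreasing) (auto simp: field_simps)
    also have "\<dots> \<le> (1 - 1 / q) ^ g"
      using p1 pleq by (intro power_mono) (auto simp: field_simps frac_le)
    finally show "(1 - 1 / real p) ^ d \<le> (1 - 1 / q) ^ g" .
  qed (use p1 q1 pq in \<open>auto simp: b_def Q_def\<close>)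
  ultimately have "((1 - 1 / p) ^ d * b)\<^sup>2 * (real p ^ d) ^ v \<le> U\<^sup>2 * (real n)\<^sup>2" by simp
  also have "((1 - 1 / p) ^ d * b)\<^sup>2 * (real p ^ d) ^ v
    = b\<^sup>2 * (real (p ^ v) ^ d * (1 - 1 / real p) ^ (2 * d))"
    by (simp add: power_mult_distrib mult_ac flip: power_mult)
  finally show ?thesis
    using U0 by (simp add: field_simps b_def[symmetric] U_def[symmetric])
qed

end

section \<open>The Galois test\<close>

lemma (in cring) exists_maximalideal:
  assumes I: "ideal I R" and one: "\<one> \<notin> I"
  shows "\<exists>M. maximalideal M R \<and> I \<subseteq> M"
proof -
  let ?A = "{J. ideal J R \<and> I \<subseteq> J \<and> \<one> \<notin> J}"
  have "\<exists>M\<in>?A. \<forall>J\<in>?A. M \<subseteq> J \<longrightarrow> J = M"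
  proof (rule subset_Zorn_nonempty)
    show "?A \<noteq> {}" using assms by blast
  next
    fix C assume C: "C \<noteq> {}" "subset.chain ?A C"
    then have "subset.chain {J. ideal J R} C" by (auto simp: pred_on.chain_def)
    from chain_Union_is_ideal[OF this] have "ideal (\<Union>C) R" using C(1) by simp
    then show "\<Union>C \<in> ?A" using C by (auto simp: pred_on.chain_def)
  qed
  then obtain M where MA: "M \<in> ?A" and max: "\<forall>J\<in>?A. M \<subseteq> J \<longrightarrow> J = M" by (rule bexE)
  from MA have M: "ideal M R" "I \<subseteq> M" "\<one> \<notin> M" by simp_all
  have "maximalideal M R"
  proof (rule maximalidealI[OF M(1)])
    show "carrier R \<noteq> M" using M(3) one_closed by blast
    fix J assume "ideal J R" "M \<subseteq> J" "J \<subseteq> carrier R"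
    then show "J = M \<or> J = carrier R"
      using M(2) max ideal.one_imp_carrier[of J R] by (cases "\<one> \<in> J") auto
  qed
  with M show ?thesis by blast
qed

lemma (in cring) residue_field:
  assumes M: "maximalideal M R"
  shows "field (R Quot M)" and "(+>) M \<in> ring_hom R (R Quot M)"
    and "(+>) M ` carrier R = carrier (R Quot M)"
    and "x \<in> carrier R \<Longrightarrow> M +> x = \<zero>\<^bsub>R Quot M\<^esub> \<longleftrightarrow> x \<in> M"
proof -
  interpret M: maximalideal M R by (rule M)
  show "field (R Quot M)" using M.quotient_is_field is_cring by blast
  show "(+>) M \<in> ring_hom R (R Quot M)" by (rule M.rcos_ring_hom)
  show "(+>) M ` carrier R = carrier (R Quot M)"
    by (auto simp: FactRing_def A_RCOSETS_def')
  show "x \<in> carrier R \<Longrightarrow> M +> x = \<zero>\<^bsub>R Quot M\<^esub> \<longleftrightarrow> x \<in> M"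
    using M.a_rcos_self[of x] M.a_rcos_const[of x] by (auto simp: FactRing_def)
qed

section \<open>Iterates of the generator of a cyclic algebra\<close>

context cyclic_algebra
begin

lemma cring_S: "cring S"
  using algebra_axioms by (rule algebra.axioms)

lemma subgroup_algebra_auts: "subgroup (algebra_auts R S) (BijGroup (carrier S))"
proof (rule group.subgroupI[OF group_BijGroup])
  interpret S: cring S by (rule cring_S)
  show "algebra_auts R S \<subseteq> carrier (BijGroup (carrier S))"
    by (auto simp: algebra_auts_def BijGroup_def)
  have "(\<lambda>x\<in>carrier S. x) \<in> algebra_auts R S"
    by (auto simp: algebra_auts_def id_Bij ring_hom_def)
  then show "algebra_auts R S \<noteq> {}" by blast
next
  interpret S: cring S by (rule cring_S)
  fix f assume f: "f \<in> algebra_auts R S"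
  let ?h = "\<lambda>x\<in>carrier S. inv_into (carrier S) f x"
  have fB: "f \<in> Bij (carrier S)" and fh: "f \<in> ring_hom S S"
    and fs: "\<And>a s. a \<in> carrier R \<Longrightarrow> s \<in> carrier S \<Longrightarrow> f (a \<odot>\<^bsub>S\<^esub> s) = a \<odot>\<^bsub>S\<^esub> f s"
    using f by (auto simp: algebra_auts_def)
  have inj: "inj_on f (carrier S)" and im: "f ` carrier S = carrier S"
    using fB by (auto simp: Bij_def bij_betw_def)
  have h: "?h x \<in> carrier S" "f (?h x) = x" if "x \<in> carrier S" for x
    using that im by (auto simp: inv_into_into f_inv_into_f)
  have hI: "?h y = x" if "x \<in> carrier S" "f x = y" for x y
    using that inj im by (auto simp: inv_into_f_f)
  have "?h \<in> ring_hom S S"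
  proof (rule ring_hom_memI)
    fix x y assume xy: "x \<in> carrier S" "y \<in> carrier S"
    show "?h (x \<otimes>\<^bsub>S\<^esub> y) = ?h x \<otimes>\<^bsub>S\<^esub> ?h y"
      using h xy by (intro hI) (simp_all add: ring_hom_mult[OF fh])
    show "?h (x \<oplus>\<^bsub>S\<^esub> y) = ?h x \<oplus>\<^bsub>S\<^esub> ?h y"
      using h xy by (intro hI) (simp_all add: ring_hom_add[OF fh])
  next
    show "?h \<one>\<^bsub>S\<^esub> = \<one>\<^bsub>S\<^esub>" by (intro hI) (simp_all add: ring_hom_one[OF fh])
  qed (use h in blast)
  moreover have "?h (a \<odot>\<^bsub>S\<^esub> s) = a \<odot>\<^bsub>S\<^esub> ?h s" if "a \<in> carrier R" "s \<in> carrier S" for a s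
    using h that by (intro hI) (simp_all add: fs)
  moreover have "?h \<in> Bij (carrier S)" using fB by (rule restrict_inv_into_Bij)
  ultimately show "inv\<^bsub>BijGroup (carrier S)\<^esub> f \<in> algebra_auts R S"
    unfolding inv_BijGroup[OF fB] algebra_auts_def by blast
next
  interpret S: cring S by (rule cring_S)
  fix f f' assume f: "f \<in> algebra_auts R S" and f': "f' \<in> algebra_auts R S"
  have "compose (carrier S) f f' \<in> ring_hom S S"
    using f f' by (auto simp: algebra_auts_def ring_hom_def compose_def Pi_iff)
  moreover have "compose (carrier S) f f' \<in> Bij (carrier S)"
    using f f' by (intro compose_Bij) (auto simp: algebra_auts_def)
  moreover have "compose (carrier S) f f' (a \<odot>\<^bsub>S\<^esub> s) = a \<odot>\<^bsub>S\<^esub> compose (carrier S) f f' s"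
    if "a \<in> carrier R" "s \<in> carrier S" for a s
  proof -
    have "f' s \<in> carrier S" using f' that by (auto simp: algebra_auts_def ring_hom_def)
    then show ?thesis using f f' that by (auto simp: algebra_auts_def compose_def)
  qed
  ultimately show "f \<otimes>\<^bsub>BijGroup (carrier S)\<^esub> f' \<in> algebra_auts R S"
    using f f' by (auto simp: algebra_auts_def BijGroup_def)
qed

lemma group_AlgebraAutGroup: "group (AlgebraAutGroup R S)"
  unfolding AlgebraAutGroup_def
  by (rule group.subgroup_imp_group[OF group_BijGroup subgroup_algebra_auts])

lemma sigma_auts: "\<sigma> \<in> algebra_auts R S"
  using aut by (simp add: AlgebraAutGroup_def)

text \<open>Powers in the automorphism group are extensional, whereas iterates are not restricted;
  already at exponent 0 they need agree only on the carrier.\<close>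

lemma aut_pow_apply:
  assumes "x \<in> carrier S"
  shows "(\<sigma> [^]\<^bsub>AlgebraAutGroup R S\<^esub> (i::nat)) x = (\<sigma> ^^ i) x"
  using assms
proof (induction i arbitrary: x)
  case 0
  then show ?case by (simp add: AlgebraAutGroup_def BijGroup_def)
next
  case (Suc i)
  interpret A: group "AlgebraAutGroup R S" by (rule group_AlgebraAutGroup)
  have sx: "\<sigma> x \<in> carrier S" using sigma_auts Suc.prems by (auto simp: algebra_auts_def ring_hom_def)
  have B: "f \<in> Bij (carrier S)" if "f \<in> carrier (AlgebraAutGroup R S)" for f
    using that by (simp add: AlgebraAutGroup_def algebra_auts_def)
  have "(\<sigma> [^]\<^bsub>AlgebraAutGroup R S\<^esub> Suc i) x = (\<sigma> [^]\<^bsub>AlgebraAutGroup R S\<^esub> i) (\<sigma> x)"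
    using B[OF aut] B[OF A.nat_pow_closed[OF aut, of i]] Suc.prems
    by (simp add: AlgebraAutGroup_def BijGroup_def compose_def)
  then show ?case using Suc.IH[OF sx] by (simp add: funpow_swap1)
qed

lemma ord_sigma: "group.ord (AlgebraAutGroup R S) \<sigma> = d"
  using group.generate_pow_card[OF group_AlgebraAutGroup aut] order_G by (simp add: G_def)

lemma sigma_funpow_d:
  assumes "x \<in> carrier S"
  shows "(\<sigma> ^^ d) x = x"
proof -
  have "\<sigma> [^]\<^bsub>AlgebraAutGroup R S\<^esub> d = \<one>\<^bsub>AlgebraAutGroup R S\<^esub>"
    using group.pow_ord_eq_1[OF group_AlgebraAutGroup aut] by (simp add: ord_sigma)
  then show ?thesis
    using aut_pow_apply[OF assms, of d] assms by (simp add: AlgebraAutGroup_def BijGroup_def)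
qed

lemma sigma_fixed_imp_scalar:
  assumes "x \<in> carrier S" "\<sigma> x = x"
  shows "\<exists>a\<in>carrier R. x = a \<odot>\<^bsub>S\<^esub> \<one>\<^bsub>S\<^esub>"
proof -
  have fp: "(\<sigma> ^^ i) x = x" for i using assms(2) by (induction i) auto
  have "\<tau> x = x" if "\<tau> \<in> G" for \<tau>
    using that group.generate_pow_nat[OF group_AlgebraAutGroup aut] ord_sigma dim_pos
      aut_pow_apply[OF assms(1)] fp by (auto simp: G_def)
  then have "x \<in> fixed_elements S G" using assms by (simp add: fixed_elements_def)
  then show ?thesis using fixed by (auto simp: bij_betw_def)
qed

lemma galois_funpow:
  assumes "0 < i" "i < d" "maximalideal M S"
  shows "\<exists>s\<in>carrier S. (\<sigma> ^^ i) s \<ominus>\<^bsub>S\<^esub> s \<notin> M"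
proof -
  interpret A: group "AlgebraAutGroup R S" by (rule group_AlgebraAutGroup)
  let ?\<tau> = "\<sigma> [^]\<^bsub>AlgebraAutGroup R S\<^esub> i"
  have "?\<tau> \<in> G" using A.generate_pow_nat[OF aut] ord_sigma dim_pos by (auto simp: G_def)
  moreover have "?\<tau> \<noteq> \<one>\<^bsub>AlgebraAutGroup R S\<^esub>"
    using A.pow_eq_id[OF aut, of i] ord_sigma assms by (auto dest: dvd_imp_le)
  ultimately obtain s where "s \<in> carrier S" "?\<tau> s \<ominus>\<^bsub>S\<^esub> s \<notin> M" using galois assms(3) by blast
  then show ?thesis using aut_pow_apply by auto
qed

end

section \<open>From cyclic algebras to residue fields and the Galois test\<close>

lemma galois_bad_density_sq_le:
  fixes n p v d :: nat and S :: "(int, 'a, 'y) module_scheme"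
  assumes S: "cyclic_algebra (residue_ring (int n)) S \<sigma> d"
    and n: "n > 1" "\<not> primepow n"
    and p: "Factorial_Ring.prime p" "v > 0" "p ^ v dvd n" "coprime p (n div p ^ v)"
  shows "(bad_density (galois_test n S \<sigma>))\<^sup>2 * (real (p ^ v) ^ d * (1 - 1 / real p) ^ (2 * d)) \<le> (real n)\<^sup>2"
proof (cases "finite (Units S)")
  case False
  \<comment> \<open>Then the density is a division by the junk value \<open>card (Units S) = 0\<close>.\<close>
  then show ?thesis by (simp add: bad_density_def galois_test_def)
next
  case fin: True
  let ?R = "residue_ring (int n)"
  interpret R: residues "int n" ?R by (rule residues.intro) (use n in auto)
  interpret cyclic_algebra ?R S \<sigma> d "generate (AlgebraAutGroup ?R S) {\<sigma>}"
    by (rule S) 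
  interpret S: cring S by (rule cring_S)
  \<comment> \<open>The carrier of the scalar ring consists of reduced residues, so an integer is
    reduced before it acts.\<close>
  define \<iota> where "\<iota> k = (k mod int n) \<odot>\<^bsub>S\<^esub> \<one>\<^bsub>S\<^esub>" for k :: int
  have \<iota>c: "\<iota> k \<in> carrier S" for k by (simp add: \<iota>_def)
  interpret S: int_cring S \<iota>
  proof
    fix k l :: int
    show "\<iota> k \<in> carrier S" by (rule \<iota>c)
    show "\<iota> (k + l) = \<iota> k \<oplus>\<^bsub>S\<^esub> \<iota> l"
      unfolding \<iota>_def R.add_cong[symmetric] by (rule smult_l_distr) auto
    have "\<iota> (k * l) = (k mod int n) \<odot>\<^bsub>S\<^esub> \<iota> l"
      unfolding \<iota>_def R.mult_cong[symmetric] by (rule smult_assoc1) auto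
    also have "\<dots> = (k mod int n) \<odot>\<^bsub>S\<^esub> (\<one>\<^bsub>S\<^esub> \<otimes>\<^bsub>S\<^esub> \<iota> l)" using \<iota>c by simp
    also have "\<dots> = \<iota> k \<otimes>\<^bsub>S\<^esub> \<iota> l"
      unfolding \<iota>_def[of k] by (rule smult_assoc2[symmetric]) (use \<iota>c in auto)
    finally show "\<iota> (k * l) = \<iota> k \<otimes>\<^bsub>S\<^esub> \<iota> l" .
    show "\<iota> 1 = \<one>\<^bsub>S\<^esub>"
      unfolding \<iota>_def R.one_cong[symmetric] by simp
  qed
  have \<iota>0: "\<iota> k = \<zero>\<^bsub>S\<^esub> \<longleftrightarrow> int n dvd k" for k
  proof
    assume "\<iota> k = \<zero>\<^bsub>S\<^esub>"
    also have "\<zero>\<^bsub>S\<^esub> = \<iota> 0" by simp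
    finally have "k mod int n = 0 mod int n"
      unfolding \<iota>_def by (rule inj_onD[OF bij_betw_imp_inj_on[OF fixed]]) (simp_all only: R.mod_in_carrier)
    then show "int n dvd k" by auto
  next
    assume "int n dvd k"
    then have "\<iota> k = \<iota> 0" by (simp add: \<iota>_def)
    then show "\<iota> k = \<zero>\<^bsub>S\<^esub>" by simp
  qed
  \<comment> \<open>Some maximal ideal lies above \<open>p\<close>: if \<open>p\<close> were a unit
    of \<open>S\<close>, the quotient of \<open>n\<close> by \<open>p\<close> would be 0 in
    \<open>S\<close>, against the injectivity of scalars.\<close>
  let ?I = "PIdl\<^bsub>S\<^esub> (\<iota> (int p))"
  have "\<one>\<^bsub>S\<^esub> \<notin> ?I"
  proof
    assume "\<one>\<^bsub>S\<^esub> \<in> ?I"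
    then obtain x where x: "x \<in> carrier S" "\<one>\<^bsub>S\<^esub> = x \<otimes>\<^bsub>S\<^esub> \<iota> (int p)" by (auto simp: cgenideal_def)
    obtain m where m: "n = p * m" using p(2,3) by (metis dvd_def dvd_power dvd_trans)
    have "\<iota> (int m) = (x \<otimes>\<^bsub>S\<^esub> \<iota> (int p)) \<otimes>\<^bsub>S\<^esub> \<iota> (int m)" by (simp flip: x(2))
    also have "\<dots> = x \<otimes>\<^bsub>S\<^esub> \<iota> (int n)" using x(1) m by (simp add: m_assoc S.iota_mult)
    also have "\<dots> = \<zero>\<^bsub>S\<^esub>" using \<iota>0[of "int n"] x(1) by simp
    finally have "n dvd m" using \<iota>0 by simp
    moreover have "m > 0" using m n(1) by (auto intro: ccontr)
    ultimately have "n \<le> m" by (auto dest: dvd_imp_le)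
    then show False using m \<open>m > 0\<close> prime_gt_1_nat[OF p(1)] by simp
  qed
  then have "\<exists>M. maximalideal M S \<and> ?I \<subseteq> M"
    by (rule cring.exists_maximalideal[OF cring_S cring.cgenideal_ideal[OF cring_S \<iota>c]])
  then obtain M where M: "maximalideal M S" "?I \<subseteq> M" by (elim exE conjE)
  let ?K = "S Quot M" and ?\<pi> = "(+>\<^bsub>S\<^esub>) M"
  note K = cring.residue_field[OF cring_S M(1)]
  have pM: "\<iota> (int p) \<in> M" using M(2) cgenideal_self[OF \<iota>c] by blast
  have "coprime (int (p ^ v)) (int (n div p ^ v))" using p(4) by simp
  then obtain e where e: "[e = 1] (mod int (p ^ v))" "[e = 0] (mod int (n div p ^ v))"
    using binary_chinese_remainder_int by blast
  have \<sigma>h: "\<sigma> \<in> ring_hom S S" using sigma_auts by (simp add: algebra_auts_def)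
  have "local_cyclic_ring_axioms S \<iota> ?K \<sigma> d n p v e ?\<pi>"
  proof
    show "\<sigma> (\<iota> k) = \<iota> k" for k
      using sigma_auts by (auto simp: \<iota>_def algebra_auts_def ring_hom_one)
    show "\<exists>k. x = \<iota> k" if x: "x \<in> carrier S" "\<sigma> x = x" for x
    proof -
      obtain a where a: "a \<in> carrier ?R" "x = a \<odot>\<^bsub>S\<^esub> \<one>\<^bsub>S\<^esub>" using sigma_fixed_imp_scalar[OF x] by blast
      then have "a mod int n = a" by (auto simp: R.res_carrier_eq)
      then show ?thesis using a(2) by (metis \<iota>_def)
    qed
    show "\<exists>s\<in>carrier S. ?\<pi> ((\<sigma> ^^ i) s) \<noteq> ?\<pi> s" if i: "0 < i" "i < d" for i
    proof -
      obtain s where s: "s \<in> carrier S" "(\<sigma> ^^ i) s \<ominus>\<^bsub>S\<^esub> s \<notin> M" using galois_funpow[OF i M(1)] by blast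
      have ss: "(\<sigma> ^^ i) s \<in> carrier S"
        using s(1) \<sigma>h by (induction i) (auto simp: ring_hom_def)
      have "?\<pi> ((\<sigma> ^^ i) s) \<noteq> ?\<pi> s"
      proof
        assume eq: "?\<pi> ((\<sigma> ^^ i) s) = ?\<pi> s"
        then show False
          using ring.quotient_eq_iff_same_a_r_cos[OF cring.axioms(1)[OF cring_S] maximalideal.axioms(1)[OF M(1)] ss s(1)] s(2)
          by simp
      qed
      with s(1) show ?thesis by blast
    qed
    show "?\<pi> (\<iota> (int p)) = \<zero>\<^bsub>?K\<^esub>" using pM K(4)[OF \<iota>c] by blast
  qed (use sigma_funpow_d dim_pos n p e \<iota>0 \<sigma>h K(2,3) in auto)
  then have L: "local_cyclic_ring S \<iota> ?K \<sigma> d n p v e ?\<pi>"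
    using local_cyclic_ring.intro[OF S.int_cring_axioms K(1)] by blast
  have "bad_witnesses (galois_test n S \<sigma>) = local_cyclic_ring.bad S \<sigma> n"
    unfolding local_cyclic_ring.bad_def[OF L] by (auto simp: bad_witnesses_def galois_test_def)
  then show ?thesis
    using local_cyclic_ring.bad_density_sq_le[OF L fin n(2)] by (simp add: bad_density_def galois_test_def)
qed

text \<open>The largest of the prime powers whose product is \<open>n\<close> is at least their
  geometric mean.\<close>

lemma exists_large_prime_power_factor:
  fixes n :: nat
  assumes "n > 1"
  shows "\<exists>p v. Factorial_Ring.prime p \<and> v > 0 \<and> p ^ v dvd n \<and> coprime p (n div p ^ v)
    \<and> n \<le> (p ^ v) ^ card (prime_factors n)"
proof -
  let ?P = "prime_factors n" and ?f = "\<lambda>p. p ^ multiplicity p n"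
  have ne: "?P \<noteq> {}" using assms by (auto simp: prime_factorization_empty_iff)
  have "Max (?f ` ?P) \<in> ?f ` ?P" using ne by (intro Max_in) auto
  then obtain p where p: "p \<in> ?P" "Max (?f ` ?P) = ?f p" by blast
  let ?v = "multiplicity p n"
  have pp: "Factorial_Ring.prime p" "p dvd n" using p(1) by (auto simp: in_prime_factors_iff)
  have "n = (\<Prod>q\<in>?P. ?f q)" using assms by (intro prime_factorization_nat) auto
  also have "\<dots> \<le> (\<Prod>q\<in>?P. ?f p)"
    using p(2) by (intro prod_mono) (auto intro!: Max_ge simp flip: p(2))
  also have "\<dots> = ?f p ^ card ?P" by simp
  finally have le: "n \<le> (p ^ ?v) ^ card ?P" .
  have v: "?v > 0" using pp assms by (simp add: prime_multiplicity_gt_zero_iff)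
  obtain m where m: "n = p ^ ?v * m" "\<not> p dvd m"
    using multiplicity_decompose'[of n p] pp assms by (metis not_prime_unit not_one_less_zero)
  then have "n div p ^ ?v = m" using prime_gt_0_nat[OF pp(1)] by (metis nonzero_mult_div_cancel_left power_not_zero less_numeral_extra(3))
  then have "coprime p (n div p ^ ?v)" using m(2) pp(1) by (simp add: prime_imp_coprime)
  then show ?thesis using pp(1) v le by (intro exI[of _ p] exI[of _ ?v]) (auto simp: multiplicity_dvd)
qed

theorem theorem4:
  fixes A B C :: real and n r d :: nat
    and S :: "(int, 'a) module" and \<sigma> :: "'a \<Rightarrow> 'a"
  assumes "A > 2" and "B \<ge> 4 * A / (A - 2)"
    and "C = 1 - 2 / A - 4 / B"
    and "n > 1" and "\<not> primepow n"
    and "\<And>p :: nat. Factorial_Ring.prime p \<Longrightarrow> p dvd n \<Longrightarrow> \<not> real p < B"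
    and "r > 0" and "d > 0"
    and "real d * real r * (1 - A / real d) \<le> A\<^sup>2 * C * ln (real n) / (2 * ln 2)"
    and "cyclic_algebra (residue_ring (int n)) S \<sigma> d"
  shows "bad_density
           (pair_test (family_test {..<r} (\<lambda>_. miller_rabin_test n)) (galois_test n S \<sigma>))
         \<le> 2 powr (- (real r * real d / A) * (1 - A / real d))"
proof -
  let ?mr = "bad_density (miller_rabin_test n)" and ?gal = "bad_density (galois_test n S \<sigma>)"
  let ?s = "card (prime_factors n)"
  \<comment> \<open>This makes \<open>n\<close> odd and the weight \<open>1 / 2 - 2 / B\<close>
    positive.\<close>
  have B4: "B > 4"
  proof -
    have "4 * A / (A - 2) > 4" using assms(1) by (simp add: field_simps)
    then show ?thesis using assms(2) by linarith
  qed
  have big: "real p \<ge> B" if "Factorial_Ring.prime p" "p dvd n" for p :: nat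
    using assms(6)[OF that] by simp
  have "odd n"
  proof
    assume "even n"
    then have "real 2 \<ge> B" by (intro big) auto
    with B4 show False by simp
  qed
  have s1: "?s \<ge> 1"
    using assms(4) by (auto simp: Suc_le_eq card_gt_0_iff prime_factorization_empty_iff)
  have density: "bad_density
      (pair_test (family_test {..<r} (\<lambda>_. miller_rabin_test n)) (galois_test n S \<sigma>)) = ?mr ^ r * ?gal"
    by (simp add: bad_density_pair_test bad_density_family_test_const)
  have nonneg: "?mr \<ge> 0" "?gal \<ge> 0" by (simp_all add: bad_density_def)
  have exponent: "- (real r * real d / A) * (1 - A / real d) = real r - real r * real d / A"
    using assms(1,8) by (simp add: field_simps)
  show ?thesis
  proof (cases "real d \<le> real ?s * A")
    case True
    have "?mr * 2 ^ (?s - 1) \<le> 1"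
      by (rule miller_rabin_bad_density[OF \<open>odd n\<close> assms(4)])
    then have "?mr \<le> 1 / 2 ^ (?s - 1)" by (simp add: field_simps)
    also have "\<dots> = 2 powr (1 - real ?s)"
      using s1 by (simp add: powr_diff powr_realpow power_diff field_simps)
    finally have "?mr ^ r \<le> (2 powr (1 - real ?s)) ^ r" using nonneg by (intro power_mono)
    also have "\<dots> = 2 powr ((1 - real ?s) * real r)" by (simp add: powr_powr flip: powr_realpow)
    finally have "?mr ^ r * ?gal \<le> 2 powr ((1 - real ?s) * real r) * 1"
      using nonneg by (intro mult_mono bad_density_le_one) auto
    also have "\<dots> \<le> 2 powr (real r - real r * real d / A)"
    proof -
      have "real r * (real d / A) \<le> real r * real ?s"
        using True assms(1) by (intro mult_left_mono) (auto simp: field_simps)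
      then show ?thesis by (simp add: algebra_simps)
    qed
    finally show ?thesis unfolding density exponent .
  next
    case False
    obtain p v where p: "Factorial_Ring.prime p" "v > 0" "p ^ v dvd n" "coprime p (n div p ^ v)"
      and n_le: "n \<le> (p ^ v) ^ ?s"
      using exists_large_prime_power_factor[OF assms(4)] by blast
    have pB: "real p \<ge> B" using p big by (metis dvd_power dvd_trans)
    then have p4: "real p > 4" using B4 by simp
    define L where "L = ln (real (p ^ v))"
    have "p ^ 1 \<le> p ^ v" using p prime_gt_0_nat[OF p(1)] by (intro power_increasing) auto
    then have "exp 1 \<le> real (p ^ v)"
      using exp_le p4 by (simp flip: of_nat_power)
    then have L1: "L \<ge> 1" using p4 by (simp add: L_def ln_ge_iff)
    have lnn: "ln (real n) \<le> real ?s * L"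
    proof -
      have "real n \<le> real ((p ^ v) ^ ?s)" using n_le by (simp only: of_nat_le_iff)
      moreover have "0 < real n" using assms(4) by simp
      ultimately have "ln (real n) \<le> ln (real ((p ^ v) ^ ?s))"
        by (subst ln_le_cancel_iff) linarith+
      also have "\<dots> = real ?s * L" using p4 by (simp add: L_def ln_realpow)
      finally show ?thesis .
    qed
    have gal: "?gal\<^sup>2 * (real (p ^ v) ^ d * (1 - 1 / real p) ^ (2 * d)) \<le> (real n)\<^sup>2"
      by (rule galois_bad_density_sq_le[OF assms(10,4,5) p])
    have "?gal \<le> 2 powr (real r - real r * real d / A)"
    \<comment> \<open>Logarithms require a positive density; density 0 is trivial.\<close>
    proof (cases "?gal = 0")
      case False
      then have gpos: "?gal > 0" using nonneg by simp
      have u: "1 - 1 / real p > 0" using p4 by (simp add: field_simps)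
      have "ln (?gal\<^sup>2 * (real (p ^ v) ^ d * (1 - 1 / real p) ^ (2 * d))) \<le> ln ((real n)\<^sup>2)"
        using gal gpos u p4 assms(4) by (subst ln_le_cancel_iff) (auto intro!: mult_pos_pos)
      moreover have "ln (?gal\<^sup>2 * (real (p ^ v) ^ d * (1 - 1 / real p) ^ (2 * d)))
        = 2 * ln ?gal + (real d * L + 2 * real d * ln (1 - 1 / real p))"
        using gpos u p4 by (simp add: ln_mult ln_realpow L_def)
      ultimately have 1: "2 * ln ?gal + real d * L + 2 * (real d * ln (1 - 1 / real p)) \<le> 2 * ln (real n)"
        using assms(4) by (simp add: ln_realpow)
      have "- ln (1 - 1 / real p) = ln (1 + 1 / (real p - 1))"
      proof -
        have "inverse (1 - 1 / real p) = 1 + 1 / (real p - 1)" using p4 by (simp add: field_simps)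
        then show ?thesis using u by (metis ln_inverse)
      qed
      also have "\<dots> \<le> 1 / (real p - 1)" using p4 by (intro ln_add_one_self_le_self) simp
      \<comment> \<open>\<open>B \<le> p \<le> 2 * (p - 1)\<close> and \<open>L \<ge> 1\<close>.
        Writing the error as a multiple of \<open>L\<close> lets it merge with the main term
        \<open>d * L\<close>.\<close>
      also have "\<dots> \<le> 2 * L / B"
      proof -
        have "B \<le> 2 * (real p - 1)" using pB p4 by simp
        also have "\<dots> \<le> (2 * L) * (real p - 1)" using L1 p4 by (intro mult_right_mono) auto
        finally show ?thesis using p4 B4 by (simp add: field_simps)
      qed
      finally have "real d * - ln (1 - 1 / real p) \<le> real d * (2 * L / B)"
        by (intro mult_left_mono) auto
      with 1 have 2: "2 * ln ?gal \<le> 2 * ln (real n) - real d * L + 2 * (real d * (2 * L / B))"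
        by simp
      \<comment> \<open>As the weight is positive, \<open>ln n \<le> s * L\<close> and
        \<open>s * A < d\<close> can be chained.\<close>
      have "A * ((1 / 2 - 2 / B) * ln (real n)) \<le> A * ((1 / 2 - 2 / B) * (real ?s * L))"
        using lnn assms(1) B4 by (intro mult_left_mono) (auto simp: field_simps)
      also have "\<dots> = (real ?s * A) * ((1 / 2 - 2 / B) * L)" by simp
      also have "\<dots> \<le> real d * ((1 / 2 - 2 / B) * L)"
        using \<open>\<not> real d \<le> real ?s * A\<close> B4 L1 by (intro mult_right_mono) (auto simp: field_simps)
      finally have 3: "A * ((1 / 2 - 2 / B) * ln (real n)) \<le> real d * ((1 / 2 - 2 / B) * L)" .
      have "ln ?gal \<le> - (A * C / 2 * ln (real n))"
      proof -
        \<comment> \<open>In \<open>C\<close> the term \<open>2 / A\<close> absorbs the factor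
          \<open>n\<close> of the Galois bound, and \<open>4 / B\<close> absorbs the powers of
          \<open>1 - 1 / p\<close>.\<close>
        have "A * C / 2 * ln (real n) = A * ((1 / 2 - 2 / B) * ln (real n)) - ln (real n)"
          unfolding assms(3) using assms(1) B4 by (simp add: field_simps)
        also have "\<dots> \<le> real d * ((1 / 2 - 2 / B) * L) - ln (real n)" using 3 by simp
        also have "\<dots> = (real d * L - 2 * (real d * (2 * L / B)) - 2 * ln (real n)) / 2"
          using B4 by (simp add: field_simps)
        finally show ?thesis using 2 by simp
      qed
      also have "\<dots> \<le> (real r - real r * real d / A) * ln 2"
      proof -
        have "real d * real r * (1 - A / real d) = real r * (real d - A)"
          using assms(8) by (simp add: field_simps)
        with assms(9) have "real r * (real d - A) * ln 2 \<le> A\<^sup>2 * C * ln (real n) / 2"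
          by (simp add: field_simps)
        then have "real r * (real d - A) * ln 2 / A \<le> A\<^sup>2 * C * ln (real n) / 2 / A"
          using assms(1) by (intro divide_right_mono) auto
        also have "\<dots> = A * C / 2 * ln (real n)" using assms(1) by (simp add: power2_eq_square)
        also have "real r * (real d - A) * ln 2 / A = - ((real r - real r * real d / A) * ln 2)"
          using assms(1) by (simp add: field_simps)
        finally show ?thesis by linarith
      qed
      finally have "exp (ln ?gal) \<le> exp ((real r - real r * real d / A) * ln 2)" by simp
      then show ?thesis using gpos by (simp add: powr_def)
    qed simp
    then have "?mr ^ r * ?gal \<le> 1 * 2 powr (real r - real r * real d / A)"
      using nonneg by (intro mult_mono power_le_one bad_density_le_one) auto
    then show ?thesis unfolding density exponent by simp
  qed
qed

end
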